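(* Let $\mathbb F$ be a finitely generated nontrivial free group, $\Phi\colon\mathbb F\to\mathbb F$ an automorphism, and $\mathbb G=\mathbb F\rtimes_\Phi\mathbb Z$, with $\mathbb F$ regarded as a normal subgroup of $\mathbb G$. If $\mathbb G'\le\mathbb G$ is a free-by-cyclic subgroup, then $\mathbb G'\cap\mathbb F$ is finitely generated.
   Context: A group is free-by-cyclic if it has a nontrivial finitely generated free normal subgroup whose quotient group is infinite cyclic. $\mathbb F\rtimes_\Phi\mathbb Z=\langle\mathbb F,t\mid txt^{-1}=\Phi(x)\text{ for all }x\in\mathbb F\rangle$. *)

theory Defs
  imports "HOL-Algebra.Algebra"
begin

section \<open>Finitely generated groups and free groups\<close>

definition fin_gen_group :: "('a, 'b) monoid_scheme \<Rightarrow> bool" where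
  "fin_gen_group G \<longleftrightarrow>
     group G \<and> (\<exists>S. finite S \<and> S \<subseteq> carrier G \<and> generate G S = carrier G)"

text \<open>The letter \<open>(x, True)\<close> stands for \<open>x\<close>, and \<open>(x, False)\<close> for the formal inverse of \<open>x\<close>.\<close>

definition reduced_words :: "'a set \<Rightarrow> ('a \<times> bool) list set" where
  "reduced_words B =
     {w \<in> lists (B \<times> UNIV). successively (\<lambda>(x, a) (y, b). \<not> (x = y \<and> a \<noteq> b)) w}"

definition word_val :: "('a, 'b) monoid_scheme \<Rightarrow> ('a \<times> bool) list \<Rightarrow> 'a" where
  "word_val G w =
     foldr (\<lambda>(x, a) g. (if a then x else inv\<^bsub>G\<^esub> x) \<otimes>\<^bsub>G\<^esub> g) w \<one>\<^bsub>G\<^esub>"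

text \<open>A group is free on \<open>B\<close> if the canonical map to it from the free group of reduced words
  over \<open>B\<close> is bijective, i.e. if every element is the value of exactly one reduced word.\<close>

definition free_on :: "('a, 'b) monoid_scheme \<Rightarrow> 'a set \<Rightarrow> bool" where
  "free_on G B \<longleftrightarrow>
     B \<subseteq> carrier G \<and> bij_betw (word_val G) (reduced_words B) (carrier G)"

definition free_group :: "('a, 'b) monoid_scheme \<Rightarrow> bool" where
  "free_group G \<longleftrightarrow> group G \<and> (\<exists>B. free_on G B)"

section \<open>Free-by-cyclic groups\<close>

definition free_by_cyclic :: "('a, 'b) monoid_scheme \<Rightarrow> bool" where
  "free_by_cyclic G \<longleftrightarrow>
     (\<exists>N. N \<lhd> G
        \<and> \<not> trivial_group (G\<lparr>carrier := N\<rparr>)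
        \<and> fin_gen_group (G\<lparr>carrier := N\<rparr>)
        \<and> free_group (G\<lparr>carrier := N\<rparr>)
        \<and> (G Mod N) \<cong> integer_group)"

section \<open>The semidirect product with the integers\<close>

text \<open>The pair \<open>(x, m)\<close> stands for \<open>x t\<^sup>m\<close>, where \<open>t = (\<one>, 1)\<close> is the stable letter.\<close>

definition semidirect_int ::
    "('a, 'b) monoid_scheme \<Rightarrow> ('a \<Rightarrow> 'a) \<Rightarrow> ('a \<times> int) monoid" where
  "semidirect_int F \<Phi> =
     \<lparr>carrier = carrier F \<times> UNIV,
      monoid.mult = (\<lambda>(x, m) (y, n). (x \<otimes>\<^bsub>F\<^esub> (\<Phi> [^]\<^bsub>AutoGroup F\<^esub> m) y, m + n)),
      one = (\<one>\<^bsub>F\<^esub>, 0)\<rparr>"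

context group
begin

lemma carrier_AutoGroup: "carrier (AutoGroup G) = auto G"
  by (simp add: AutoGroup_def)

lemma AutoGroup_mult_apply:
  assumes "f \<in> auto G" "g \<in> auto G" "x \<in> carrier G"
  shows "(f \<otimes>\<^bsub>AutoGroup G\<^esub> g) x = f (g x)"
  using assms by (simp add: AutoGroup_def BijGroup_def auto_def compose_def)

lemma AutoGroup_one_apply: "x \<in> carrier G \<Longrightarrow> \<one>\<^bsub>AutoGroup G\<^esub> x = x"
  by (simp add: AutoGroup_def BijGroup_def)

lemma auto_hom: "f \<in> auto G \<Longrightarrow> f \<in> hom G G"
  by (simp add: auto_def)

lemma auto_int_pow: "\<Phi> \<in> auto G \<Longrightarrow> \<Phi> [^]\<^bsub>AutoGroup G\<^esub> (m::int) \<in> auto G"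
  using group.int_pow_closed[OF AutoGroup] by (simp add: carrier_AutoGroup)

lemma auto_int_pow_add:
  assumes "\<Phi> \<in> auto G" "x \<in> carrier G"
  shows "(\<Phi> [^]\<^bsub>AutoGroup G\<^esub> (m + n :: int)) x
       = (\<Phi> [^]\<^bsub>AutoGroup G\<^esub> m) ((\<Phi> [^]\<^bsub>AutoGroup G\<^esub> n) x)"
  using assms group.int_pow_mult[OF AutoGroup, of \<Phi> m n]
  by (simp add: carrier_AutoGroup AutoGroup_mult_apply auto_int_pow)

lemma group_semidirect_int:
  assumes \<Phi>: "\<Phi> \<in> auto G"
  shows "group (semidirect_int G \<Phi>)"
proof -
  let ?P = "\<lambda>m::int. \<Phi> [^]\<^bsub>AutoGroup G\<^esub> m"
  have hom: "?P m \<in> hom G G" for m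
    by (intro auto_hom auto_int_pow \<Phi>)
  have cl [simp]: "?P m x \<in> carrier G" if "x \<in> carrier G" for m x
    using hom_in_carrier[OF hom that] .
  have mult: "?P m (x \<otimes> y) = ?P m x \<otimes> ?P m y" if "x \<in> carrier G" "y \<in> carrier G" for m x y
    using hom_mult[OF hom that] .
  have zero [simp]: "?P 0 x = x" if "x \<in> carrier G" for x
    using that by (simp add: AutoGroup_one_apply)
  have one [simp]: "?P m \<one> = \<one>" for m
    using hom_one[OF hom is_group is_group] .
  show ?thesis
  proof (rule groupI)
    fix u assume "u \<in> carrier (semidirect_int G \<Phi>)"
    then obtain x m where u: "u = (x, m)" and x: "x \<in> carrier G"
      by (auto simp: semidirect_int_def)
    have "?P (-m) (inv x) \<otimes> ?P (-m) x = \<one>"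
      using x mult[of "inv x" x "-m"] by simp
    then show "\<exists>v\<in>carrier (semidirect_int G \<Phi>).
        v \<otimes>\<^bsub>semidirect_int G \<Phi>\<^esub> u = \<one>\<^bsub>semidirect_int G \<Phi>\<^esub>"
      using x by (intro bexI[of _ "(?P (-m) (inv x), -m)"])
        (simp_all add: semidirect_int_def u)
  qed (auto simp: semidirect_int_def mult auto_int_pow_add[OF \<Phi>] m_assoc
      AutoGroup_one_apply)
qed

lemma normal_semidirect_int:
  assumes \<Phi>: "\<Phi> \<in> auto G"
  shows "carrier G \<times> {0} \<lhd> semidirect_int G \<Phi>"
proof -
  interpret S: group "semidirect_int G \<Phi>"
    using group_semidirect_int[OF \<Phi>] .
  have "snd \<in> hom (semidirect_int G \<Phi>) integer_group"
    by (auto simp: hom_def semidirect_int_def)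
  then interpret h: group_hom "semidirect_int G \<Phi>" integer_group snd
    using S.is_group group_integer_group by (intro group_hom.intro group_hom_axioms.intro)
  have "kernel (semidirect_int G \<Phi>) integer_group snd = carrier G \<times> {0}"
    by (auto simp: kernel_def semidirect_int_def)
  then show ?thesis
    using h.normal_kernel by simp
qed

lemma iso_semidirect_int:
  assumes \<Phi>: "\<Phi> \<in> auto G"
  shows "(\<lambda>x. (x, 0)) \<in> iso G ((semidirect_int G \<Phi>)\<lparr>carrier := carrier G \<times> {0}\<rparr>)"
  by (auto simp: iso_def hom_def semidirect_int_def AutoGroup_one_apply bij_betw_def inj_on_def)

lemma semidirect_int_conj:
  assumes \<Phi>: "\<Phi> \<in> auto G" and x: "x \<in> carrier G"
  shows "(\<one>, 1) \<otimes>\<^bsub>semidirect_int G \<Phi>\<^esub> (x, 0) \<otimes>\<^bsub>semidirect_int G \<Phi>\<^esub>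
           inv\<^bsub>semidirect_int G \<Phi>\<^esub> (\<one>, 1) = (\<Phi> x, 0)"
proof -
  interpret S: group "semidirect_int G \<Phi>"
    using group_semidirect_int[OF \<Phi>] .
  have \<Phi>x: "\<Phi> x \<in> carrier G"
    using hom_in_carrier[OF auto_hom[OF \<Phi>] x] .
  have c: "(\<one>, 1) \<in> carrier (semidirect_int G \<Phi>)" "(x, 0) \<in> carrier (semidirect_int G \<Phi>)"
      "(\<Phi> x, 0) \<in> carrier (semidirect_int G \<Phi>)"
    using x \<Phi>x by (simp_all add: semidirect_int_def)
  have "\<Phi> [^]\<^bsub>AutoGroup G\<^esub> (1::int) = \<Phi>"
    using \<Phi> by (simp add: group.int_pow_1[OF AutoGroup] carrier_AutoGroup)
  moreover have "(\<Phi> [^]\<^bsub>AutoGroup G\<^esub> (0::int)) \<one> = \<one>"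
    by (simp add: AutoGroup_one_apply)
  ultimately have "(\<one>, 1) \<otimes>\<^bsub>semidirect_int G \<Phi>\<^esub> (x, 0)
      = (\<Phi> x, 0) \<otimes>\<^bsub>semidirect_int G \<Phi>\<^esub> (\<one>, 1)"
    using \<Phi>x by (simp add: semidirect_int_def)
  then show ?thesis
    using c by (metis S.inv_solve_right' S.m_closed)
qed

end

end

theory Submission
  imports Defs "HOL-Library.Function_Algebras" "HOL-Library.Z2"
begin

text \<open>Let \<open>H\<close> be the subgroup, \<open>N\<close> its finitely generated normal subgroup with infinite cyclic
  quotient, \<open>K = H \<inter> F\<close> and \<open>L = K \<inter> N\<close>. Apart from easy cases \<open>N = L \<langle>y\<rangle>\<close> and
  \<open>K = L \<langle>u\<rangle>\<close>, where no positive power of \<open>u\<close> is in \<open>L\<close>. The mod 2 homology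
  of \<open>L\<close> embeds into the edge chains of the Schreier graph of \<open>L\<close> in \<open>F\<close>, on which \<open>u\<close>
  acts without nonzero fixed points, so \<open>u - 1\<close> is injective on it. It is generated by
  finitely many elements and their conjugates under powers of \<open>y\<close>, and \<open>u\<close> commutes with
  \<open>y\<close> on it; the span of the conjugates by \<open>y\<^sup>j\<close> with \<open>-n \<le> j \<le> n\<close> has linear growth in
  \<open>n\<close>, and \<open>u - 1\<close> maps it injectively into the one for some \<open>n + c\<close>. Hence the cokernel of
  \<open>u - 1\<close> is finite. Therefore the mod 2 homology of \<open>K\<close> is finite, and \<open>K\<close>, being free, is
  finitely generated: outside a spanning tree its Schreier graph has only finitely many edges.\<close>

section \<open>Cocycles on free groups\<close>

text \<open>The sum of \<open>d\<close> along the path in the Cayley graph that the word spells from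
  the vertex \<open>g\<close>. An inverse letter runs backwards through its edge, so it subtracts
  the edge that starts at the next vertex \<open>g \<otimes> inv x\<close>.\<close>

fun word_cocycle ::
    "('a, 'b) monoid_scheme \<Rightarrow> ('a \<Rightarrow> 'a \<Rightarrow> 'v::ab_group_add) \<Rightarrow> 'a \<Rightarrow> ('a \<times> bool) list \<Rightarrow> 'v" where
  "word_cocycle G d g [] = 0"
| "word_cocycle G d g ((x, True) # w) = d g x + word_cocycle G d (g \<otimes>\<^bsub>G\<^esub> x) w"
| "word_cocycle G d g ((x, False) # w) =
     - d (g \<otimes>\<^bsub>G\<^esub> inv\<^bsub>G\<^esub> x) x + word_cocycle G d (g \<otimes>\<^bsub>G\<^esub> inv\<^bsub>G\<^esub> x) w"

lemma reduced_words_ConsD: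
  assumes "l # w \<in> reduced_words B"
  shows "fst l \<in> B" "w \<in> reduced_words B"
  using assms unfolding reduced_words_def by (cases w; auto)+

text \<open>Left multiplication by a letter on normal forms: the letter is either prepended or
  cancels the head.\<close>

lemma reduced_words_Cons_cases:
  assumes "w \<in> reduced_words B" "b \<in> B"
  obtains "(b, a) # w \<in> reduced_words B"
  | w' where "w = (b, \<not> a) # w'" "w' \<in> reduced_words B"
proof (cases "(b, a) # w \<in> reduced_words B")
  case False
  then obtain w' where "w = (b, \<not> a) # w'"
    using assms by (cases w) (auto simp: reduced_words_def)
  then show thesis
    using assms(1) reduced_words_ConsD that(2) by blast
qed (rule that(1))

section \<open>Evaluation of words and cocycles with prescribed values on a basis\<close>

context group
begin

lemma word_val_closed:
  assumes "B \<subseteq> carrier G" "w \<in> lists (B \<times> UNIV)"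
  shows "word_val G w \<in> carrier G"
  using assms(2)
proof (induction w)
  case Nil
  then show ?case by (simp add: word_val_def)
next
  case (Cons l w)
  then show ?case using assms(1) by (cases l) (auto simp: word_val_def)
qed

lemma word_val_Cons:
  "word_val G ((x, a) # w) = (if a then x else inv x) \<otimes> word_val G w"
  by (simp add: word_val_def)

lemma word_val_in_generate:
  assumes "w \<in> lists (B \<times> UNIV)"
  shows "word_val G w \<in> generate G B"
  using assms
proof (induction w)
  case Nil
  then show ?case by (simp add: word_val_def generate.one)
next
  case (Cons l w)
  then show ?case
    by (cases l) (auto simp: word_val_Cons intro: generate.intros)
qed

lemma free_on_generate:
  assumes "free_on G B"
  shows "generate G B = carrier G"
proof
  show "generate G B \<subseteq> carrier G"
    using assms generate_incl by (auto simp: free_on_def)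
next
  show "carrier G \<subseteq> generate G B"
  proof
    fix x assume "x \<in> carrier G"
    then obtain w where "w \<in> reduced_words B" "x = word_val G w"
      using assms by (auto simp: free_on_def bij_betw_def)
    then show "x \<in> generate G B"
      using word_val_in_generate by (auto simp: reduced_words_def)
  qed
qed

text \<open>On a free group a cocycle may be prescribed on the basis: \<open>D g x\<close> evaluates
  \<open>word_cocycle\<close> on the unique reduced word of \<open>x\<close>. The cocycle identity
  is checked for a single letter on the left and then extended by induction on the reduced word of
  the left factor.\<close>

lemma free_on_cocycle_exists:
  fixes d :: "'a \<Rightarrow> 'a \<Rightarrow> 'v::ab_group_add"
  assumes free: "free_on G B"
  obtains D where
    "\<And>g b. \<lbrakk>g \<in> carrier G; b \<in> B\<rbrakk> \<Longrightarrow> D g b = d g b"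
    "\<And>g x y. \<lbrakk>g \<in> carrier G; x \<in> carrier G; y \<in> carrier G\<rbrakk>
       \<Longrightarrow> D g (x \<otimes> y) = D g x + D (g \<otimes> x) y"
proof -
  define r where "r = the_inv_into (reduced_words B) (word_val G)"
  define D where "D g x = word_cocycle G d g (r x)" for g x
  have B: "B \<subseteq> carrier G" and bij: "bij_betw (word_val G) (reduced_words B) (carrier G)"
    using free by (auto simp: free_on_def)
  have r_val: "r (word_val G w) = w" if "w \<in> reduced_words B" for w
    using bij that by (simp add: r_def bij_betw_def the_inv_into_f_f)
  have ex: "\<exists>w \<in> reduced_words B. x = word_val G w" if "x \<in> carrier G" for x
    using bij that by (auto simp: bij_betw_def)
  have cl: "word_val G w \<in> carrier G" if "w \<in> reduced_words B" for w
    using bij that by (auto simp: bij_betw_def)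
  have red1: "[(b, a)] \<in> reduced_words B" if "b \<in> B" for a b
    using that by (simp add: reduced_words_def)
  have D_val: "D g (word_val G w) = word_cocycle G d g w" if "w \<in> reduced_words B" for g w
    using that by (simp add: D_def r_val)
  have letter: "D g (b \<otimes> y) = d g b + D (g \<otimes> b) y"
      "D g (inv b \<otimes> y) = - d (g \<otimes> inv b) b + D (g \<otimes> inv b) y"
    if gy: "g \<in> carrier G" "y \<in> carrier G" and b: "b \<in> B" for g b y
  proof -
    have bc: "b \<in> carrier G" using b B by auto
    obtain w where w: "w \<in> reduced_words B" "y = word_val G w" using ex gy by blast
    show "D g (b \<otimes> y) = d g b + D (g \<otimes> b) y"
    proof (rule reduced_words_Cons_cases[OF w(1) b, of True])
      assume "(b, True) # w \<in> reduced_words B"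
      from D_val[OF this, of g] w show ?thesis
        by (simp add: word_val_Cons D_val)
    next
      \<comment> \<open>The new letter cancels the head of \<open>w\<close>, and the head runs
        backwards through the very edge that the letter would add, so the two contributions
        cancel.\<close>
      fix w' assume w': "w = (b, \<not> True) # w'" "w' \<in> reduced_words B"
      have "b \<otimes> y = word_val G w'"
        using w(2) w' bc cl[OF w'(2)] by (simp add: word_val_Cons m_assoc[symmetric])
      then show ?thesis
        using w w' bc gy D_val by (simp add: m_assoc)
    qed
    show "D g (inv b \<otimes> y) = - d (g \<otimes> inv b) b + D (g \<otimes> inv b) y"
    proof (rule reduced_words_Cons_cases[OF w(1) b, of False])
      assume "(b, False) # w \<in> reduced_words B"
      from D_val[OF this, of g] w show ?thesis
        by (simp add: word_val_Cons D_val)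
    next
      fix w' assume w': "w = (b, \<not> False) # w'" "w' \<in> reduced_words B"
      have "inv b \<otimes> y = word_val G w'"
        using w(2) w' bc cl[OF w'(2)] by (simp add: word_val_Cons m_assoc[symmetric])
      then show ?thesis
        using w w' bc gy D_val by (simp add: m_assoc)
    qed
  qed
  have nil: "[] \<in> reduced_words B" by (simp add: reduced_words_def)
  have D1: "D g \<one> = 0" for g
    using D_val[OF nil, of g] by (simp add: word_val_def)
  have "D g (word_val G w \<otimes> y) = D g (word_val G w) + D (g \<otimes> word_val G w) y"
    if "w \<in> reduced_words B" "g \<in> carrier G" "y \<in> carrier G" for g w y
    using that
  proof (induction w arbitrary: g)
    case Nil
    then show ?case by (simp add: word_val_def D1)
  next
    case (Cons l w)
    obtain b a where l: "l = (b, a)" by (cases l)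
    have b: "b \<in> B" and w: "w \<in> reduced_words B"
      using reduced_words_ConsD[OF Cons.prems(1)] l by auto
    then have "b \<in> carrier G" using B by auto
    then show ?case
      using Cons.IH[OF w, of "g \<otimes> (if a then b else inv b)"] Cons.prems(2,3) letter[OF _ _ b] cl[OF w]
      by (cases a) (simp_all add: l word_val_Cons m_assoc add.assoc)
  qed
  then have mult: "D g (x \<otimes> y) = D g x + D (g \<otimes> x) y"
    if "g \<in> carrier G" "x \<in> carrier G" "y \<in> carrier G" for g x y
    using ex that by blast
  have "D g b = d g b" if "g \<in> carrier G" "b \<in> B" for g b
    using letter(1)[OF that(1) one_closed that(2)] D1 that B by auto
  then show thesis using mult that by blast
qed

end

text \<open>Renaming the letters along \<open>h\<close> is a bijection between the reduced words,
  and evaluation commutes with it.\<close>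

lemma free_on_iso:
  assumes G: "group G" and G': "group G'" and h: "h \<in> iso G G'" and free: "free_on G B"
  shows "free_on G' (h ` B)"
proof -
  interpret group_hom G G' h
    using assms by (auto simp: iso_def intro: group_hom.intro group_hom_axioms.intro)
  have bh: "bij_betw h (carrier G) (carrier G')" using h by (simp add: iso_def)
  have B: "B \<subseteq> carrier G" and bij: "bij_betw (word_val G) (reduced_words B) (carrier G)"
    using free by (auto simp: free_on_def)
  let ?m = "map (map_prod h id)"
  have inj: "inj_on h B"
    using bh B by (auto simp: bij_betw_def intro: inj_on_subset)
  then have [simp]: "h x = h y \<longleftrightarrow> x = y" if "x \<in> B" "y \<in> B" for x y
    using that by (simp add: inj_on_eq_iff)
  have red: "?m w \<in> reduced_words (h ` B)" if "w \<in> reduced_words B" for w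
  proof -
    have wB: "x \<in> B" if "(x, a) \<in> set w" for x a
      using that \<open>w \<in> reduced_words B\<close> by (auto simp: reduced_words_def)
    have "successively (\<lambda>(x, a) (y, b). \<not> (x = y \<and> a \<noteq> b)) (?m w)"
      unfolding successively_map
      by (rule successively_mono[of "\<lambda>(x, a) (y, b). \<not> (x = y \<and> a \<noteq> b)"])
        (use that in \<open>auto simp: reduced_words_def dest!: wB\<close>)
    then show ?thesis using that by (auto simp: reduced_words_def lists_eq_set)
  qed
  have surj: "w' \<in> ?m ` reduced_words B" if "w' \<in> reduced_words (h ` B)" for w'
  proof -
    have "w' \<in> lists (map_prod h id ` (B \<times> UNIV))"
      using that by (force simp: reduced_words_def lists_eq_set)
    then obtain w where w: "w \<in> lists (B \<times> UNIV)" "w' = ?m w"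
      unfolding lists_image by blast
    have "successively (\<lambda>(x, a) (y, b). \<not> (x = y \<and> a \<noteq> b)) w"
      by (rule successively_mono[of "\<lambda>x y. (\<lambda>(x, a) (y, b). \<not> (x = y \<and> a \<noteq> b))
            (map_prod h id x) (map_prod h id y)"])
        (use that w(2) in \<open>auto simp: reduced_words_def successively_map\<close>)
    then show ?thesis using w by (auto simp: reduced_words_def)
  qed
  have val: "word_val G' (?m w) = h (word_val G w)" if "w \<in> lists (B \<times> UNIV)" for w
    using that
  proof (induction w)
    case Nil
    then show ?case by (simp add: word_val_def)
  next
    case (Cons l w)
    then have "word_val G w \<in> carrier G" "fst l \<in> carrier G"
      using B G.word_val_closed[OF B] by auto
    then show ?case using Cons
      by (cases l) (auto simp: G.word_val_Cons H.word_val_Cons)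
  qed
  have "inj_on (map_prod h id) (B \<times> UNIV)"
    by (auto simp: inj_on_def)
  then have "inj_on (map_prod h id) (set v \<union> set w)"
    if "v \<in> reduced_words B" "w \<in> reduced_words B" for v w
    by (rule inj_on_subset) (use that in \<open>auto simp: reduced_words_def lists_eq_set\<close>)
  then have inj_m: "inj_on ?m (reduced_words B)"
    by (intro inj_onI) (blast dest: map_inj_on)
  have bm: "bij_betw ?m (reduced_words B) (reduced_words (h ` B))"
    using inj_m red surj by (auto simp: bij_betw_def)
  have "bij_betw (h \<circ> word_val G) (reduced_words B) (carrier G')"
    using bij bh by (rule bij_betw_trans)
  then have "bij_betw (word_val G' \<circ> ?m) (reduced_words B) (carrier G')"
    by (rule bij_betw_cong[THEN iffD1, rotated]) (simp add: val reduced_words_def)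
  then have "bij_betw (word_val G') (reduced_words (h ` B)) (carrier G')"
    using bij_betw_comp_iff[OF bm] by blast
  then show ?thesis using B by (auto simp: free_on_def)
qed

section \<open>Edge cocycles of Schreier graphs\<close>

text \<open>\<open>D g x\<close> counts modulo 2 how often the path labelled \<open>x\<close> from the vertex \<open>S g\<close> of the
  Schreier graph on the right cosets of \<open>S\<close> runs through each edge; the edge \<open>(S g, b)\<close> leads
  from \<open>S g\<close> to \<open>S g b\<close>.\<close>

locale edge_cocycle = group G for G (structure) +
  fixes B S :: "'a set" and D :: "'a \<Rightarrow> 'a \<Rightarrow> 'a set \<times> 'a \<Rightarrow> bit"
  assumes gens_closed: "B \<subseteq> carrier G"
    and generate_gens: "generate G B = carrier G"
    and subgroup_S: "subgroup S G"
    and D_gen: "\<lbrakk>g \<in> carrier G; b \<in> B\<rbrakk> \<Longrightarrow> D g b = (\<lambda>e. of_bool (e = (S #> g, b)))"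
    and D_mult: "\<lbrakk>g \<in> carrier G; x \<in> carrier G; y \<in> carrier G\<rbrakk>
                   \<Longrightarrow> D g (x \<otimes> y) = D g x + D (g \<otimes> x) y"

lemma (in group) edge_cocycle_exists:
  assumes "free_on G B" "subgroup S G"
  obtains D where "edge_cocycle G B S D"
proof -
  obtain D :: "'a \<Rightarrow> 'a \<Rightarrow> 'a set \<times> 'a \<Rightarrow> bit" where
    "\<And>g b. \<lbrakk>g \<in> carrier G; b \<in> B\<rbrakk> \<Longrightarrow> D g b = (\<lambda>e. of_bool (e = (S #> g, b)))"
    "\<And>g x y. \<lbrakk>g \<in> carrier G; x \<in> carrier G; y \<in> carrier G\<rbrakk>
       \<Longrightarrow> D g (x \<otimes> y) = D g x + D (g \<otimes> x) y"
    using free_on_cocycle_exists[OF assms(1), of "\<lambda>g b e. of_bool (e = (S #> g, b))"] by metis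
  moreover have "B \<subseteq> carrier G" using assms(1) by (simp add: free_on_def)
  ultimately have "edge_cocycle G B S D"
    using assms free_on_generate is_group
    by (auto intro!: edge_cocycle.intro edge_cocycle_axioms.intro)
  then show thesis by (rule that)
qed

lemma bit_fun_add_self [simp]: "(f :: 'e \<Rightarrow> bit) + f = 0"
  by (auto simp: fun_eq_iff)

lemma bit_fun_uminus [simp]: "- (f :: 'e \<Rightarrow> bit) = f"
  by (auto simp: fun_eq_iff)

section \<open>Paths, translations and loops in the Schreier graph\<close>

lemma bit_fun_add_eq_0_iff: "(f :: 'e \<Rightarrow> bit) + g = 0 \<longleftrightarrow> f = g"
  by (metis bit_fun_uminus eq_neg_iff_add_eq_0)

context edge_cocycle
begin

lemma S_subset: "S \<subseteq> carrier G"
  using subgroup_S subgroup.subset by blast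

lemma D_one [simp]: "g \<in> carrier G \<Longrightarrow> D g \<one> = 0"
  using D_mult[of g \<one> \<one>] by simp

lemma D_inv:
  assumes "g \<in> carrier G" "x \<in> carrier G"
  shows "D g (inv x) = D (g \<otimes> inv x) x"
  using D_mult[of g "inv x" x] assms by (simp add: bit_fun_add_eq_0_iff)

lemma gen_induct [consumes 1, case_names one gen inv mult]:
  assumes "x \<in> carrier G" "P \<one>" "\<And>b. b \<in> B \<Longrightarrow> P b"
    "\<And>x. \<lbrakk>x \<in> carrier G; P x\<rbrakk> \<Longrightarrow> P (inv x)"
    "\<And>x y. \<lbrakk>x \<in> carrier G; y \<in> carrier G; P x; P y\<rbrakk> \<Longrightarrow> P (x \<otimes> y)"
  shows "P x"
proof -
  have "x \<in> generate G B" using assms(1) generate_gens by simp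
  then have "x \<in> carrier G \<and> P x"
    by induction (use assms(2-) gens_closed in auto)
  then show ?thesis ..
qed

lemma D_finite:
  assumes "x \<in> carrier G" "g \<in> carrier G"
  shows "finite {e. D g x e \<noteq> 0}"
  using assms
proof (induction arbitrary: g rule: gen_induct)
  case (mult x y)
  then have "finite ({e. D g x e \<noteq> 0} \<union> {e. D (g \<otimes> x) y e \<noteq> 0})" by auto
  then show ?case
    by (rule finite_subset[rotated]) (use mult in \<open>auto simp: D_mult simp del: bit_not_zero_iff\<close>)
qed (auto simp: D_gen D_inv)

lemma D_support:
  assumes "x \<in> carrier G" "g \<in> carrier G" "D g x (c, b) \<noteq> 0"
  shows "b \<in> B \<and> (\<exists>h\<in>carrier G. c = S #> h)"
  using assms
proof (induction arbitrary: g rule: gen_induct)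
  case (mult x y)
  then have "D g x (c, b) \<noteq> 0 \<or> D (g \<otimes> x) y (c, b) \<noteq> 0"
    by (auto simp: D_mult simp del: bit_not_zero_iff)
  then show ?case using mult by (meson m_closed)
next
  case (inv x)
  then show ?case by (metis D_inv inv_closed m_closed)
qed (auto simp: D_gen split: if_splits)

text \<open>The vertices are right cosets of \<open>S\<close>, so \<open>g\<close> and
  \<open>s \<otimes> g\<close> are the same starting point.\<close>

lemma D_left:
  assumes "x \<in> carrier G" "g \<in> carrier G" "s \<in> S"
  shows "D (s \<otimes> g) x = D g x"
  using assms
proof (induction arbitrary: g rule: gen_induct)
  case (gen b)
  then have "s \<in> carrier G" using S_subset by auto
  then have "S #> (s \<otimes> g) = S #> g"
    using gen subgroup_S S_subset by (simp add: coset_mult_assoc[symmetric] coset_join2)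
  then show ?case using gen \<open>s \<in> carrier G\<close> by (simp add: D_gen)
next
  case (inv x)
  then show ?case using S_subset by (auto simp: D_inv m_assoc subset_eq)
next
  case (mult x y)
  then show ?case using S_subset by (auto simp: D_mult m_assoc subset_eq)
qed (use S_subset in \<open>auto simp: subset_eq\<close>)

text \<open>An element normalizing \<open>S\<close> acts on the Schreier graph by the deck
  transformation \<open>c \<mapsto> u <# c\<close>, which keeps labels and carries the path from
  \<open>g\<close> to the path from \<open>u \<otimes> g\<close>.\<close>

lemma D_translate:
  assumes "x \<in> carrier G" "g \<in> carrier G" "u \<in> carrier G" "u <# S = S #> u" "c \<subseteq> carrier G"
  shows "D (u \<otimes> g) x (u <# c, b) = D g x (c, b)"
  using assms
proof (induction arbitrary: g rule: gen_induct)
  case (gen b')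
  have "S #> (u \<otimes> g) = u <# (S #> g)"
    using gen S_subset by (simp add: coset_assoc coset_mult_assoc)
  moreover have "u <# c = u <# (S #> g) \<longleftrightarrow> c = S #> g"
  proof
    assume "u <# c = u <# (S #> g)"
    then have "inv u <# (u <# c) = inv u <# (u <# (S #> g))" by simp
    then show "c = S #> g"
      using gen S_subset by (simp add: lcos_m_assoc r_coset_subset_G lcos_mult_one)
  qed simp
  ultimately show ?case using gen by (simp add: D_gen)
next
  case (inv x)
  then show ?case by (auto simp: D_inv m_assoc)
next
  case (mult x y)
  then show ?case by (auto simp: D_mult m_assoc)
qed auto

text \<open>Elements of \<open>S\<close> label closed paths at the base vertex, and running through
  two loops adds their edge counts. For a free group with basis \<open>B\<close> the image of
  \<open>S\<close> is its mod 2 homology.\<close>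

lemma D_hom:
  assumes "x \<in> S" "y \<in> S"
  shows "D \<one> (x \<otimes> y) = D \<one> x + D \<one> y"
  using assms S_subset D_left[of y \<one> x] by (auto simp: D_mult subset_eq)

lemma D_hom_inv:
  assumes "x \<in> S"
  shows "D \<one> (inv x) = D \<one> x"
  using assms S_subset D_left[of x \<one> "inv x"] subgroup.m_inv_closed[OF subgroup_S]
  by (auto simp: D_inv subset_eq)

text \<open>The path of the conjugate runs along \<open>u\<close>, then \<open>x\<close>, then back
  along \<open>u\<close> from the same vertex; modulo 2 the two runs along \<open>u\<close> cancel.
  So \<open>D u x\<close> is the action of \<open>u\<close> on the class of
  \<open>x\<close>.\<close>

lemma D_conj:
  assumes "x \<in> S" "u \<in> carrier G" "u \<otimes> x \<otimes> inv u \<in> S"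
  shows "D \<one> (u \<otimes> x \<otimes> inv u) = D u x"
proof -
  have x: "x \<in> carrier G" using assms S_subset by auto
  have "u \<otimes> x = (u \<otimes> x \<otimes> inv u) \<otimes> u"
    using x assms by (simp add: m_assoc)
  then have "D (u \<otimes> x) (inv u) = D u (inv u)"
    using D_left[of "inv u" u "u \<otimes> x \<otimes> inv u"] assms by simp
  also have "\<dots> = D \<one> u"
    using assms by (simp add: D_inv)
  finally have "D \<one> (u \<otimes> x \<otimes> inv u) = D \<one> u + D u x + D \<one> u"
    using x assms by (simp add: D_mult)
  also have "\<dots> = (D \<one> u + D \<one> u) + D u x"
    by (simp only: ac_simps)
  finally show ?thesis by simp
qed

text \<open>An element of infinite order modulo \<open>S\<close> moves every finite nonempty set of edges.\<close>

lemma D_fixed_imp_zero: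
  assumes u: "u \<in> carrier G" "u <# S = S #> u" "\<And>n::nat. u [^] n \<in> S \<Longrightarrow> n = 0"
    and x: "x \<in> carrier G" and fixed: "D u x = D \<one> x"
  shows "D \<one> x = 0"
proof (rule ccontr)
  assume "D \<one> x \<noteq> 0"
  then obtain c b where cb: "D \<one> x (c, b) \<noteq> 0" by (force simp: fun_eq_iff)
  then obtain h where h: "h \<in> carrier G" "c = S #> h"
    using D_support[OF x one_closed] by blast
  have c: "c \<subseteq> carrier G" using h S_subset by (simp add: r_coset_subset_G)
  have step: "D \<one> x (u <# c', b) = D \<one> x (c', b)" if "c' \<subseteq> carrier G" for c'
    using D_translate[OF x one_closed u(1,2) that, of b] u(1) fixed by simp
  \<comment> \<open>The support is invariant under \<open>u\<close>, hence contains the whole orbit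
    of the edge. The orbit is infinite, since a repetition would put a positive power of
    \<open>u\<close> into \<open>S\<close>.\<close>
  have nz: "D \<one> x (u [^] n <# c, b) \<noteq> 0" for n :: nat
  proof (induction n)
    case (Suc n)
    have "u [^] Suc n = u \<otimes> u [^] n" using u(1) by (rule nat_pow_Suc2)
    then have "u [^] Suc n <# c = u <# (u [^] n <# c)"
      using u c by (simp only: lcos_m_assoc nat_pow_closed)
    moreover have "u [^] n <# c \<subseteq> carrier G" using u c by (simp add: l_coset_subset_G)
    ultimately show ?case using Suc step by simp
  qed (use cb c in \<open>simp add: lcos_mult_one\<close>)
  have "inj (\<lambda>n::nat. (u [^] n <# c, b))"
  proof (rule linorder_injI)
    fix m n :: nat assume "m < n"
    show "(u [^] m <# c, b) \<noteq> (u [^] n <# c, b)"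
    proof
      assume "(u [^] m <# c, b) = (u [^] n <# c, b)"
      then have "u [^] m <# c = u [^] m <# (u [^] (n - m) <# c)"
        using u c \<open>m < n\<close> by (simp add: lcos_m_assoc nat_pow_mult)
      then have "inv (u [^] m) <# (u [^] m <# c) = inv (u [^] m) <# (u [^] m <# (u [^] (n - m) <# c))"
        by simp
      then have "c = u [^] (n - m) <# c"
        using u c by (simp add: lcos_m_assoc lcos_mult_one l_coset_subset_G m_assoc[symmetric])
      moreover have "h \<in> c" using h rcos_self subgroup_S by blast
      ultimately have "u [^] (n - m) \<otimes> h \<in> c" by (auto simp: l_coset_def)
      then obtain s where "s \<in> S" "u [^] (n - m) \<otimes> h = s \<otimes> h"
        using h by (auto simp: r_coset_def)
      then have "u [^] (n - m) \<in> S" using h u S_subset by (auto simp: subset_eq)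
      then show False using u(3) \<open>m < n\<close> by fastforce
    qed
  qed
  then have "infinite (range (\<lambda>n::nat. (u [^] n <# c, b)))"
    by (rule range_inj_infinite)
  moreover have "range (\<lambda>n::nat. (u [^] n <# c, b)) \<subseteq> {e. D \<one> x e \<noteq> 0}" using nz by auto
  ultimately show False using D_finite[OF x one_closed] finite_subset by blast
qed

end

section \<open>Comparison of the Schreier graphs of nested subgroups\<close>

text \<open>The graph of \<open>S\<close> covers that of \<open>S'\<close>: a coset of
  \<open>S\<close> goes to the coset of \<open>S'\<close> containing it. The path downstairs is the
  image of the path upstairs, so its count at an edge is the sum over the fibre.\<close>

lemma D_pushforward:
  fixes G (structure)
  assumes "edge_cocycle G B S D" "edge_cocycle G B S' D'" "S \<subseteq> S'"
    and "x \<in> carrier G" "g \<in> carrier G" "c \<in> rcosets S'"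
  shows "D' g x (c, b) = (\<Sum>e | D g x e \<noteq> 0 \<and> fst e \<subseteq> c \<and> snd e = b. D g x e)"
proof -
  interpret edge_cocycle G B S D by fact
  interpret E': edge_cocycle G B S' D' by fact
  obtain k where k: "k \<in> carrier G" "c = S' #> k" using assms(6) by (auto simp: RCOSETS_def)
  have sub: "S #> h \<subseteq> c \<longleftrightarrow> c = S' #> h" if h: "h \<in> carrier G" for h
  proof
    assume "S #> h \<subseteq> c"
    then have "h \<in> S' #> k" using rcos_self[OF h subgroup_S] k by auto
    then show "c = S' #> h" using repr_independence[OF _ k(1) E'.subgroup_S] k by simp
  next
    assume "c = S' #> h" then show "S #> h \<subseteq> c" using assms(3) by (auto simp: r_coset_def)
  qed
  show ?thesis using assms(4,5)
  proof (induction arbitrary: g rule: gen_induct)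
    case (gen a)
    have "{e. D g a e \<noteq> 0 \<and> fst e \<subseteq> c \<and> snd e = b} =
        {e. e = (S #> g, a) \<and> S #> g \<subseteq> c \<and> a = b}"
      using gen by (auto simp: D_gen)
    also have "\<dots> = (if c = S' #> g \<and> a = b then {(S #> g, a)} else {})"
      unfolding sub[OF gen(2)] by auto
    finally have "{e. D g a e \<noteq> 0 \<and> fst e \<subseteq> c \<and> snd e = b} =
        (if c = S' #> g \<and> a = b then {(S #> g, a)} else {})" .
    then show ?case using gen by (auto simp: D_gen E'.D_gen)
  next
    case (inv x)
    then show ?case by (simp add: D_inv E'.D_inv del: bit_not_zero_iff)
  next
    case (mult x y)
    \<comment> \<open>Edges may cancel in the sum of the two paths, so all three sums are first
      extended to one finite set containing both supports.\<close>
    let ?A = "{e. fst e \<subseteq> c \<and> snd e = b}"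
    let ?U = "({e. D g x e \<noteq> 0} \<union> {e. D (g \<otimes> x) y e \<noteq> 0}) \<inter> ?A"
    have fin: "finite ?U" using mult by (auto intro: D_finite simp del: bit_not_zero_iff)
    have "(\<Sum>e | D g (x \<otimes> y) e \<noteq> 0 \<and> fst e \<subseteq> c \<and> snd e = b. D g (x \<otimes> y) e) = (\<Sum>e\<in>?U. D g (x \<otimes> y) e)"
      using mult by (intro sum.mono_neutral_left fin) (auto simp: D_mult simp del: bit_not_zero_iff)
    also have "\<dots> = (\<Sum>e\<in>?U. D g x e) + (\<Sum>e\<in>?U. D (g \<otimes> x) y e)"
      using mult by (simp only: D_mult plus_fun_apply sum.distrib)
    also have "(\<Sum>e\<in>?U. D g x e) = (\<Sum>e | D g x e \<noteq> 0 \<and> fst e \<subseteq> c \<and> snd e = b. D g x e)"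
      by (intro sum.mono_neutral_right fin) auto
    also have "(\<Sum>e\<in>?U. D (g \<otimes> x) y e) =
        (\<Sum>e | D (g \<otimes> x) y e \<noteq> 0 \<and> fst e \<subseteq> c \<and> snd e = b. D (g \<otimes> x) y e)"
      by (intro sum.mono_neutral_right fin) auto
    finally show ?case using mult by (simp only: E'.D_mult plus_fun_apply m_closed)
  qed auto
qed

text \<open>Pushing forward zero gives zero. Thus the inclusion of \<open>S\<close> into
  \<open>S'\<close> induces a well-defined map on classes of loops.\<close>

lemma D_zero_mono:
  fixes G (structure)
  assumes "edge_cocycle G B S D" "edge_cocycle G B S' D'" "S \<subseteq> S'"
    and "x \<in> carrier G" "g \<in> carrier G" "D g x = 0"
  shows "D' g x = 0"
proof (rule ccontr)
  interpret E': edge_cocycle G B S' D' by fact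
  assume "D' g x \<noteq> 0"
  then obtain c b where cb: "D' g x (c, b) \<noteq> 0" by (force simp: fun_eq_iff)
  then have "c \<in> rcosets S'"
    using E'.D_support[OF assms(4,5)] by (force simp: RCOSETS_def)
  then show False using D_pushforward[OF assms(1-5), of c b] cb assms(6) by simp
qed

section \<open>Finite generation from finite cycle space\<close>

context edge_cocycle
begin

lemma rcoset_mult: "\<lbrakk>c \<in> rcosets S; x \<in> carrier G\<rbrakk> \<Longrightarrow> c #> x \<in> rcosets S"
  using S_subset by (auto simp: RCOSETS_def coset_mult_assoc)

lemma rcoset_mult_assoc:
  "\<lbrakk>c \<in> rcosets S; x \<in> carrier G; y \<in> carrier G\<rbrakk> \<Longrightarrow> c #> x #> y = c #> (x \<otimes> y)"
  using S_subset by (auto simp: RCOSETS_def coset_mult_assoc m_assoc)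

lemma rcoset_mult_one: "c \<in> rcosets S \<Longrightarrow> c #> \<one> = c"
  using S_subset by (auto simp: RCOSETS_def coset_mult_assoc)

lemma S_rcoset: "S \<in> rcosets S"
  using subgroup_S subgroup.subgroup_in_rcosets is_group by blast

text \<open>A breadth-first spanning tree of the Schreier graph: \<open>T\<close> is its set of
  edges, and \<open>\<sigma> c\<close> is the label of the tree path from the root \<open>S\<close>
  to \<open>c\<close>, which gives a Schreier transversal.\<close>

lemma schreier_tree:
  obtains \<sigma> T where "\<sigma> S = \<one>"
    "\<And>c. c \<in> rcosets S \<Longrightarrow> \<sigma> c \<in> carrier G"
    "\<And>c. c \<in> rcosets S \<Longrightarrow> S #> \<sigma> c = c"
    "\<And>c b. \<lbrakk>(c, b) \<in> T; b \<in> B; c \<in> rcosets S\<rbrakk> \<Longrightarrow> \<sigma> (c #> b) = \<sigma> c \<otimes> b"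
    "\<And>c e. \<lbrakk>c \<in> rcosets S; D \<one> (\<sigma> c) e \<noteq> 0\<rbrakk> \<Longrightarrow> e \<in> T"
proof -
  define letter where "letter b p = (if p then b else inv b)" for b p
  have letter_closed: "letter b p \<in> carrier G" if "b \<in> B" for b p
    using that gens_closed by (auto simp: letter_def)
  \<comment> \<open>\<open>R n\<close> consists of the cosets reached from \<open>S\<close> by
    exactly \<open>n\<close> steps, forwards or backwards along edges; \<open>d\<close> below is
    then the distance from the root.\<close>
  define R where "R = rec_nat {S} (\<lambda>n Q. {c #> letter b p |c b p. c \<in> Q \<and> b \<in> B})"
  have R0: "R 0 = {S}" and RS: "R (Suc n) = {c #> letter b p |c b p. c \<in> R n \<and> b \<in> B}" for n
    by (simp_all add: R_def)
  have R_rcos: "c \<in> rcosets S" if "c \<in> R n" for n c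
    using that
  proof (induction n arbitrary: c)
    case 0
    then show ?case by (simp add: R0 S_rcoset)
  next
    case (Suc n)
    then show ?case by (auto simp: RS intro!: rcoset_mult letter_closed)
  qed
  have "\<forall>c\<in>(\<Union>n. R n). c #> x \<in> (\<Union>n. R n)" if "x \<in> generate G B" for x
    using that
  proof induction
    case one
    have "c #> \<one> = c" if "c \<in> R n" for c n
      using R_rcos[OF that] by (rule rcoset_mult_one)
    then show ?case by auto
  next
    case (incl b)
    then have "c #> b \<in> R (Suc n)" if "c \<in> R n" for c n
      unfolding RS letter_def using that by force
    then show ?case by blast
  next
    case (inv b)
    then have "c #> inv b \<in> R (Suc n)" if "c \<in> R n" for c n
      unfolding RS letter_def using that by force
    then show ?case by blast
  next
    case (eng x y)
    show ?case
    proof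
      fix c assume c: "c \<in> (\<Union>n. R n)"
      then have "c #> x #> y \<in> (\<Union>n. R n)" using eng by blast
      then show "c #> (x \<otimes> y) \<in> (\<Union>n. R n)"
        using c R_rcos eng generate_gens by (auto simp: rcoset_mult_assoc)
    qed
  qed
  then have "S #> x \<in> (\<Union>n. R n)" if "x \<in> carrier G" for x
    using that R0 generate_gens by blast
  then have R_all: "\<exists>n. c \<in> R n" if "c \<in> rcosets S" for c
    using that by (auto simp: RCOSETS_def)
  define d where "d c = (LEAST n. c \<in> R n)" for c
  have dR: "c \<in> R (d c)" if "c \<in> rcosets S" for c
    using R_all[OF that] unfolding d_def by (auto intro: LeastI)
  have d_le: "d c \<le> n" if "c \<in> R n" for c n
    using that unfolding d_def by (rule Least_le)
  \<comment> \<open>The last coset before \<open>c\<close> on a shortest path is one step closer to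
    the root. Choosing one such neighbour as \<open>par c\<close> makes the tree.\<close>
  have "\<exists>c' b p. c' \<in> rcosets S \<and> b \<in> B \<and> c = c' #> letter b p \<and> d c = Suc (d c')"
    if c: "c \<in> rcosets S" "d c \<noteq> 0" for c
  proof -
    obtain n where n: "d c = Suc n" using c(2) not0_implies_Suc by blast
    then obtain c' b p where c': "c' \<in> R n" "b \<in> B" "c = c' #> letter b p"
      using dR[OF c(1)] unfolding n RS by auto
    have "c' \<in> rcosets S" using c' R_rcos by blast
    then have "c \<in> R (Suc (d c'))" unfolding RS using c' dR by blast
    then have "d c \<le> Suc (d c')" by (rule d_le)
    with d_le[OF c'(1)] n have "d c = Suc (d c')" by simp
    with c' \<open>c' \<in> rcosets S\<close> show ?thesis by blast
  qed
  then obtain par lab pos where par: "\<And>c. \<lbrakk>c \<in> rcosets S; d c \<noteq> 0\<rbrakk> \<Longrightarrow>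
      par c \<in> rcosets S \<and> lab c \<in> B \<and> c = par c #> letter (lab c) (pos c) \<and> d c = Suc (d (par c))"
    by metis
  \<comment> \<open>The counter bounds the recursion along parents: \<open>\<tau> n c\<close>
    multiplies the labels of \<open>n\<close> parent links, and at \<open>n = d c\<close> the walk
    ends at the root.\<close>
  define \<tau> where "\<tau> = rec_nat (\<lambda>c. \<one>) (\<lambda>n t c. t (par c) \<otimes> letter (lab c) (pos c))"
  define \<sigma> where "\<sigma> c = \<tau> (d c) c" for c
  \<comment> \<open>Edges are named by their starting vertex, so a link with an inverse letter is an
    edge starting at the child.\<close>
  define edge where "edge c = (if pos c then par c else c, lab c)" for c
  define T where "T = edge ` {c \<in> rcosets S. d c \<noteq> 0}"
  have \<sigma>0: "\<sigma> c = \<one>" if "d c = 0" for c using that by (simp add: \<sigma>_def \<tau>_def)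
  have \<sigma>S: "\<sigma> c = \<sigma> (par c) \<otimes> letter (lab c) (pos c)" if "c \<in> rcosets S" "d c \<noteq> 0" for c
  proof -
    have "d c = Suc (d (par c))" using par[OF that] by blast
    then show ?thesis by (simp add: \<sigma>_def \<tau>_def)
  qed
  have \<sigma>_props: "\<sigma> c \<in> carrier G \<and> S #> \<sigma> c = c \<and> (\<forall>e. D \<one> (\<sigma> c) e \<noteq> 0 \<longrightarrow> e \<in> T)"
    if "c \<in> rcosets S" for c
    using that
  proof (induction "d c" arbitrary: c)
    case 0
    then have "c = S" using dR[of c] R0 by simp
    then show ?case using \<sigma>0[of c] 0 S_subset by (simp add: coset_mult_one)
  next
    case (Suc n)
    then have dc: "d c \<noteq> 0" by simp
    note p = par[OF Suc.prems dc]
    have IH: "\<sigma> (par c) \<in> carrier G" "S #> \<sigma> (par c) = par c"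
        "\<And>e. D \<one> (\<sigma> (par c)) e \<noteq> 0 \<Longrightarrow> e \<in> T"
      using Suc.hyps(1)[of "par c"] p Suc.hyps(2) by auto
    have b: "lab c \<in> carrier G" using p gens_closed by blast
    have l: "letter (lab c) (pos c) \<in> carrier G" using p letter_closed by blast
    have cl: "\<sigma> c \<in> carrier G" using \<sigma>S[OF Suc.prems dc] IH(1) l by simp
    have "S #> \<sigma> c = par c #> letter (lab c) (pos c)"
      using \<sigma>S[OF Suc.prems dc] IH l S_subset by (metis coset_mult_assoc)
    then have cos: "S #> \<sigma> c = c" using p by simp
    have "D (\<sigma> (par c)) (letter (lab c) (pos c)) = (\<lambda>e. of_bool (e = edge c))"
    proof (cases "pos c")
      case True
      then show ?thesis using IH p by (simp add: letter_def D_gen edge_def)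
    next
      case False
      then show ?thesis using IH(1) p b cos \<sigma>S[OF Suc.prems dc]
        by (simp add: letter_def D_inv D_gen edge_def)
    qed
    then have "D \<one> (\<sigma> c) = D \<one> (\<sigma> (par c)) + (\<lambda>e. of_bool (e = edge c))"
      using \<sigma>S[OF Suc.prems dc] IH(1) l by (simp add: D_mult)
    moreover have "edge c \<in> T" using Suc.prems dc by (auto simp: T_def)
    ultimately have "\<forall>e. D \<one> (\<sigma> c) e \<noteq> 0 \<longrightarrow> e \<in> T"
      using IH(3) by (auto simp del: bit_not_zero_iff split: if_splits)
    with cl cos show ?case by blast
  qed
  have "\<sigma> (c #> b) = \<sigma> c \<otimes> b" if cb: "(c, b) \<in> T" for c b
  proof -
    obtain k where k: "k \<in> rcosets S" "d k \<noteq> 0" "(c, b) = edge k"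
      using cb by (auto simp: T_def)
    note p = par[OF k(1,2)]
    have b: "b \<in> carrier G" using p k(3) gens_closed by (auto simp: edge_def)
    show ?thesis
    proof (cases "pos k")
      case True
      then show ?thesis using k p \<sigma>S[OF k(1,2)] by (simp add: edge_def letter_def)
    next
      case False
      then have "c = k" "lab k = b" using k(3) by (auto simp: edge_def)
      then have c: "c = par c #> inv b" using p False by (simp add: letter_def)
      have "c #> b = par c #> inv b #> b" using c by simp
      also have "\<dots> = par c #> \<one>"
        using p \<open>c = k\<close> b by (simp add: rcoset_mult_assoc)
      also have "\<dots> = par c"
        using p \<open>c = k\<close> by (simp add: rcoset_mult_one)
      finally have "c #> b = par c" .
      moreover have "\<sigma> c = \<sigma> (par c) \<otimes> inv b"
        using \<sigma>S[OF k(1,2)] False \<open>c = k\<close> \<open>lab k = b\<close> by (simp add: letter_def)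
      moreover have "\<sigma> (par c) \<in> carrier G" using \<sigma>_props p \<open>c = k\<close> by blast
      ultimately show ?thesis using b by (simp add: m_assoc)
    qed
  qed
  moreover have "\<sigma> S = \<one>"
    using \<sigma>0 d_le[of S 0] R0 by simp
  ultimately show thesis using \<sigma>_props by (intro that[of \<sigma> T]) blast+
qed

lemma finite_cycles_imp_fin_gen:
  assumes fin: "finite (D \<one> ` S)"
  obtains Y where "finite Y" "Y \<subseteq> S" "generate G Y = S"
proof -
  obtain \<sigma> T where \<sigma>1: "\<sigma> S = \<one>"
    and \<sigma>_cl: "\<And>c. c \<in> rcosets S \<Longrightarrow> \<sigma> c \<in> carrier G"
    and \<sigma>_cos: "\<And>c. c \<in> rcosets S \<Longrightarrow> S #> \<sigma> c = c"
    and tree: "\<And>c b. \<lbrakk>(c, b) \<in> T; b \<in> B; c \<in> rcosets S\<rbrakk> \<Longrightarrow> \<sigma> (c #> b) = \<sigma> c \<otimes> b"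
    and D_tree: "\<And>c e. \<lbrakk>c \<in> rcosets S; D \<one> (\<sigma> c) e \<noteq> 0\<rbrakk> \<Longrightarrow> e \<in> T"
    using schreier_tree by blast
  define \<gamma> where "\<gamma> c x = \<sigma> c \<otimes> x \<otimes> inv \<sigma> (c #> x)" for c x
  define E where "E = ((rcosets S) \<times> B) - T"
  have \<gamma>_S: "\<gamma> c x \<in> S" if c: "c \<in> rcosets S" and x: "x \<in> carrier G" for c x
  proof -
    have c': "c #> x \<in> rcosets S" using c x by (rule rcoset_mult)
    note cl = \<sigma>_cl[OF c] \<sigma>_cl[OF c'] x
    have "S #> (\<sigma> c \<otimes> x) = c #> x"
      using \<sigma>_cos[OF c] coset_mult_assoc[OF S_subset cl(1) x] by simp
    then have "S #> (\<sigma> c \<otimes> x) = S #> \<sigma> (c #> x)"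
      using \<sigma>_cos[OF c'] by simp
    then have "S #> (\<sigma> c \<otimes> x \<otimes> inv \<sigma> (c #> x)) = S"
      by (rule coset_mult_inv2) (use cl S_subset in auto)
    then show ?thesis unfolding \<gamma>_def
      by (rule coset_join1) (use cl subgroup_S in auto)
  qed
  \<comment> \<open>The outward path \<open>\<sigma> c\<close> and the return along
    \<open>\<sigma> (c #> b)\<close> stay in the tree; only the middle edge can lie outside.\<close>
  have D_\<gamma>: "D \<one> (\<gamma> c b) e = of_bool (e = (c, b))" if c: "c \<in> rcosets S" and b: "b \<in> B" and e: "e \<notin> T" for c b e
  proof -
    have bc: "b \<in> carrier G" using b gens_closed by blast
    have c': "c #> b \<in> rcosets S" using c bc by (rule rcoset_mult)
    note cl = \<sigma>_cl[OF c] \<sigma>_cl[OF c'] bc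
    have "D (\<sigma> c \<otimes> b) (inv \<sigma> (c #> b)) = D (\<gamma> c b) (\<sigma> (c #> b))"
      using cl by (simp add: D_inv \<gamma>_def)
    also have "\<dots> = D \<one> (\<sigma> (c #> b))"
      using D_left[OF cl(2) one_closed \<gamma>_S[OF c bc]] \<gamma>_S[OF c bc] S_subset by auto
    finally have "D \<one> (\<gamma> c b) = D \<one> (\<sigma> c) + D (\<sigma> c) b + D \<one> (\<sigma> (c #> b))"
      using cl by (simp add: \<gamma>_def D_mult)
    moreover have "D \<one> (\<sigma> c) e = 0" "D \<one> (\<sigma> (c #> b)) e = 0"
      using D_tree c c' e by blast+
    ultimately show ?thesis using cl b \<sigma>_cos[OF c] by (simp add: D_gen)
  qed
  have "inj_on (\<lambda>(c, b). D \<one> (\<gamma> c b)) E"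
  proof (rule inj_onI, clarify)
    fix c b c' b'
    assume E: "(c, b) \<in> E" "(c', b') \<in> E" and eq: "D \<one> (\<gamma> c b) = D \<one> (\<gamma> c' b')"
    have "D \<one> (\<gamma> c b) (c, b) = 1" using E(1) by (simp add: D_\<gamma> E_def)
    then have "D \<one> (\<gamma> c' b') (c, b) = 1" using eq by simp
    then show "c = c' \<and> b = b'" using E by (auto simp: D_\<gamma> E_def split: if_splits)
  qed
  moreover have "(\<lambda>(c, b). D \<one> (\<gamma> c b)) ` E \<subseteq> D \<one> ` S"
    using \<gamma>_S gens_closed by (auto simp: E_def)
  ultimately have finE: "finite E" using fin by (meson finite_imageD finite_subset)
  let ?Y = "(\<lambda>(c, b). \<gamma> c b) ` E"
  have Y: "?Y \<subseteq> S" using \<gamma>_S gens_closed by (auto simp: E_def)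
  have XG: "?Y \<subseteq> carrier G" using Y S_subset by blast
  have gen: "\<gamma> c b \<in> generate G ?Y" if c: "c \<in> rcosets S" and b: "b \<in> B" for c b
  proof (cases "(c, b) \<in> T")
    case True
    then have "\<gamma> c b = \<one>"
      using tree[OF True b c] c b \<sigma>_cl gens_closed by (auto simp: \<gamma>_def)
    then show ?thesis by (simp add: generate.one)
  next
    case False
    then have "\<gamma> c b \<in> ?Y" using c b by (force simp: E_def)
    then show ?thesis by (rule generate.incl)
  qed
  \<comment> \<open>Schreier rewriting: \<open>\<gamma> c (x \<otimes> y)\<close> splits into
    \<open>\<gamma> c x\<close> and \<open>\<gamma> (c #> x) y\<close>. At the root
    \<open>\<sigma> S = \<one>\<close>, so an element \<open>x\<close> of \<open>S\<close> is
    \<open>\<gamma> S x\<close>.\<close>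
  have "\<forall>c\<in>rcosets S. \<gamma> c x \<in> generate G ?Y" if "x \<in> generate G B" for x
    using that
  proof induction
    case one
    then show ?case using \<sigma>_cl rcoset_mult_one by (simp add: \<gamma>_def generate.one)
  next
    case (incl b)
    then show ?case using gen by blast
  next
    case (inv b)
    show ?case
    proof
      fix c assume c: "c \<in> rcosets S"
      have b: "b \<in> carrier G" using inv gens_closed by blast
      have c': "c #> inv b \<in> rcosets S" using c b by (simp add: rcoset_mult)
      have "c #> inv b #> b = c" using c b by (simp add: rcoset_mult_assoc rcoset_mult_one)
      then have "\<gamma> c (inv b) = inv \<gamma> (c #> inv b) b"
        using \<sigma>_cl[OF c] \<sigma>_cl[OF c'] b by (simp add: \<gamma>_def inv_mult_group m_assoc)
      then show "\<gamma> c (inv b) \<in> generate G ?Y"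
        using gen[OF c' inv] generate_m_inv_closed[OF XG] by simp
    qed
  next
    case (eng x y)
    show ?case
    proof
      fix c assume c: "c \<in> rcosets S"
      have xy: "x \<in> carrier G" "y \<in> carrier G" using eng generate_gens by auto
      have c': "c #> x \<in> rcosets S" using c xy by (simp add: rcoset_mult)
      have "\<gamma> c (x \<otimes> y) = \<gamma> c x \<otimes> \<gamma> (c #> x) y"
        using \<sigma>_cl[OF c] \<sigma>_cl[OF c'] \<sigma>_cl[OF rcoset_mult[OF c' xy(2)]] xy c
        by (simp add: \<gamma>_def rcoset_mult_assoc m_assoc inv_solve_left)
      then show "\<gamma> c (x \<otimes> y) \<in> generate G ?Y"
        using eng c c' by (simp add: generate.eng)
    qed
  qed
  then have "\<gamma> S x \<in> generate G ?Y" if "x \<in> S" for x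
    using that S_subset generate_gens S_rcoset by auto
  moreover have "\<gamma> S x = x" if "x \<in> S" for x
    using that S_subset \<sigma>1 subgroup_S by (auto simp: \<gamma>_def coset_join2)
  ultimately have "S \<subseteq> generate G ?Y" by force
  moreover have "generate G ?Y \<subseteq> S" using Y subgroup_S generate_subgroup_incl by blast
  ultimately show thesis using that[of ?Y] finE Y by blast
qed

end

section \<open>Finite cokernels from bounded growth\<close>

text \<open>Let \<open>T\<close> be finite and pairwise incongruent modulo the union of the
  \<open>A' n\<close>. It lies in one \<open>A n\<close>, and the translates of \<open>A' n\<close>
  by \<open>T\<close> are disjoint subsets of \<open>A (n + c)\<close>, so \<open>T\<close> has at
  most \<open>C\<close> elements. A largest such \<open>T\<close> represents all classes.\<close>

lemma finite_cokernel_of_growth: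
  fixes A A' :: "nat \<Rightarrow> 'v::ab_group_add set"
  assumes fin: "\<And>n. finite (A n)" and monoA: "mono A"
    and add: "\<And>n x y. \<lbrakk>x \<in> A n; y \<in> A n\<rbrakk> \<Longrightarrow> x + y \<in> A n"
    and zero: "\<And>n. 0 \<in> A' n"
    and diff: "\<And>n x y. \<lbrakk>x \<in> A' n; y \<in> A' n\<rbrakk> \<Longrightarrow> x - y \<in> A' n"
    and sub: "\<And>n. A' n \<subseteq> A (n + c)"
    and growth: "\<And>n. card (A (n + c)) \<le> C * card (A' n)"
  obtains T where "finite T" "T \<subseteq> (\<Union>n. A n)" "\<And>a. a \<in> (\<Union>n. A n) \<Longrightarrow> \<exists>t\<in>T. a - t \<in> (\<Union>n. A' n)"
proof -
  define Q where "Q T \<longleftrightarrow> finite T \<and> T \<subseteq> (\<Union>n. A n) \<and> (\<forall>s\<in>T. \<forall>t\<in>T. s - t \<in> (\<Union>n. A' n) \<longrightarrow> s = t)" for T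
  have bound: "card T \<le> C" if "Q T" for T
  proof -
    have T: "finite T" "T \<subseteq> (\<Union>n. A n)" using that by (auto simp: Q_def)
    have "\<exists>n. T \<subseteq> A n" using T
    proof (induction T)
      case (insert t T)
      then obtain m n where "T \<subseteq> A m" "t \<in> A n" by auto
      moreover have "A m \<subseteq> A (max m n)" "A n \<subseteq> A (max m n)"
        using monoA by (simp_all add: monoD)
      ultimately show ?case by blast
    qed simp
    then obtain n where "T \<subseteq> A n" ..
    then have TA: "T \<subseteq> A (n + c)" using monoD[OF monoA, of n "n + c"] by auto
    have "inj_on (\<lambda>(t, a). t + a) (T \<times> A' n)"
    proof (rule inj_onI, clarify)
      fix s a t b assume *: "s \<in> T" "a \<in> A' n" "t \<in> T" "b \<in> A' n" "s + a = t + b"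
      then have "s - t = b - a" by (simp add: algebra_simps)
      then have "s - t \<in> A' n" using diff * by simp
      then have "s = t" using that * by (auto simp: Q_def)
      then show "s = t \<and> a = b" using * by simp
    qed
    moreover have "(\<lambda>(t, a). t + a) ` (T \<times> A' n) \<subseteq> A (n + c)"
      using TA sub[of n] by (auto intro!: add)
    ultimately have "card (T \<times> A' n) \<le> card (A (n + c))"
      using fin card_inj_on_le by blast
    also have "\<dots> \<le> C * card (A' n)" by (rule growth)
    finally have "card T * card (A' n) \<le> C * card (A' n)" by (simp add: card_cartesian_product)
    moreover have "card (A' n) > 0"
      using zero[of n] finite_subset[OF sub fin] by (auto simp: card_gt_0_iff)
    ultimately show ?thesis by simp
  qed
  have "Q {}" by (simp add: Q_def)
  \<comment> \<open>The existence of a maximum is taken from a strict bound on the cardinalities,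
    hence \<open>Suc C\<close>.\<close>
  then obtain T where T: "Q T" and max: "\<And>T'. Q T' \<Longrightarrow> card T' \<le> card T"
    using ex_has_greatest_nat[of Q "{}" card "Suc C"] bound by (auto simp: less_Suc_eq_le)
  have "\<exists>t\<in>T. a - t \<in> (\<Union>n. A' n)" if a: "a \<in> (\<Union>n. A n)" for a
  proof (rule ccontr)
    assume neg: "\<not> ?thesis"
    have "t - a \<notin> (\<Union>n. A' n)" if "t \<in> T" for t
    proof
      assume "t - a \<in> (\<Union>n. A' n)"
      then obtain n where "t - a \<in> A' n" by blast
      from diff[OF zero this] have "a - t \<in> A' n" by simp
      then show False using neg that by blast
    qed
    then have "Q (insert a T)" using T a neg by (auto simp: Q_def)
    then have "card (insert a T) \<le> card T" by (rule max)
    moreover have "a \<notin> T" using neg zero by auto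
    ultimately show False using T by (simp add: Q_def)
  qed
  then show thesis using that T by (auto simp: Q_def)
qed

section \<open>Spans of finitely many loops over the field with two elements\<close>

context edge_cocycle
begin

text \<open>Modulo 2 only the parity of \<open>k\<close> matters.\<close>

lemma D_hom_int_pow:
  assumes "x \<in> S"
  shows "D \<one> (x [^] (k::int)) \<in> {0, D \<one> x}"
proof -
  have x: "x \<in> carrier G" using assms S_subset by auto
  have S_pow: "x [^] n \<in> S" for n :: nat
    using assms subgroup_S by (induction n) (auto simp: subgroup.one_closed subgroup.m_closed)
  have nat: "D \<one> (x [^] n) \<in> {0, D \<one> x}" for n :: nat
  proof (induction n)
    case (Suc n)
    then show ?case using D_hom[OF S_pow assms, of n] by auto
  qed simp
  show ?thesis
  proof (cases "k \<ge> 0")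
    case True
    then obtain n where "k = int n" using nonneg_int_cases by blast
    then show ?thesis using nat[of n] by (simp add: int_pow_int)
  next
    case False
    then obtain n where "k = - int n" using int_cases2 by (metis linorder_not_less neg_0_le_iff_le of_nat_0_le_iff)
    then show ?thesis using nat[of n] x D_hom_inv[OF S_pow, of n] by (simp add: int_pow_neg_int)
  qed
qed

text \<open>Over the field with two elements, adjoining a vector to a span adds just one translate
  of it.\<close>

lemma D_generate_insert:
  assumes "Y \<subseteq> S" "z \<in> S"
  shows "D \<one> ` generate G (insert z Y) \<subseteq>
    D \<one> ` generate G Y \<union> (\<lambda>a. a + D \<one> z) ` D \<one> ` generate G Y" (is "_ \<subseteq> ?A \<union> ?A'")
proof
  have YG: "Y \<subseteq> carrier G" and zG: "insert z Y \<subseteq> carrier G" using assms S_subset by auto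
  have gS: "generate G (insert z Y) \<subseteq> S" "generate G Y \<subseteq> S"
    using generate_subgroup_incl[OF _ subgroup_S] assms by auto
  have zero: "0 \<in> ?A" using generate.one[of G Y] D_one[OF one_closed] by (metis image_eqI)
  have z: "D \<one> z \<in> ?A'" by (rule image_eqI[OF _ zero]) simp
  have add: "a + b \<in> ?A" if "a \<in> ?A" "b \<in> ?A" for a b
  proof -
    obtain x y where "x \<in> generate G Y" "y \<in> generate G Y" "a = D \<one> x" "b = D \<one> y"
      using \<open>a \<in> ?A\<close> \<open>b \<in> ?A\<close> by blast
    then have "a + b = D \<one> (x \<otimes> y)" "x \<otimes> y \<in> generate G Y"
      using D_hom gS by (auto intro: generate.eng simp: subset_eq)
    then show ?thesis by blast
  qed
  fix v assume "v \<in> D \<one> ` generate G (insert z Y)"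
  then obtain x where x: "x \<in> generate G (insert z Y)" "v = D \<one> x" by blast
  from x(1) have "D \<one> x \<in> ?A \<union> ?A'"
  proof induction
    case one
    show ?case by (blast intro: generate.one)
  next
    case (incl h)
    then show ?case using z by (blast intro: generate.incl)
  next
    case (inv h)
    have "D \<one> (inv h) = D \<one> h" using inv assms by (auto intro: D_hom_inv)
    then show ?case using inv z by (metis UnI1 UnI2 generate.incl image_eqI insertE)
  next
    case (eng h k)
    have "D \<one> (h \<otimes> k) = D \<one> h + D \<one> k" using eng gS by (auto intro: D_hom)
    moreover have "D \<one> h + D \<one> k \<in> ?A \<union> ?A'"
    proof (cases "D \<one> h \<in> ?A"; cases "D \<one> k \<in> ?A")
      assume "D \<one> h \<in> ?A" "D \<one> k \<in> ?A"
      then show ?thesis using add by blast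
    next
      assume *: "D \<one> h \<in> ?A" "D \<one> k \<notin> ?A"
      then obtain b where "b \<in> ?A" "D \<one> k = b + D \<one> z" using eng by blast
      then show ?thesis using add[OF *(1), of b] by (auto simp: add.assoc[symmetric])
    next
      assume *: "D \<one> h \<notin> ?A" "D \<one> k \<in> ?A"
      then obtain a where a: "a \<in> ?A" "D \<one> h = a + D \<one> z" using eng by blast
      then have "D \<one> h + D \<one> k = (a + D \<one> k) + D \<one> z" by (simp only: ac_simps)
      then show ?thesis using add[OF a(1) *(2)] by blast
    next
      assume *: "D \<one> h \<notin> ?A" "D \<one> k \<notin> ?A"
      then obtain a b where ab: "a \<in> ?A" "D \<one> h = a + D \<one> z" "b \<in> ?A" "D \<one> k = b + D \<one> z"
        using eng by blast
      then have "D \<one> h + D \<one> k = (a + b) + (D \<one> z + D \<one> z)" by (simp only: ac_simps)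
      then show ?thesis using add[OF ab(1,3)] by simp
    qed
    ultimately show ?case by (simp only:)
  qed
  then show "v \<in> ?A \<union> ?A'" using x by simp
qed

text \<open>Each new generator at most doubles the span. Cardinalities thus stand in for
  dimensions.\<close>

lemma D_generate_Un:
  assumes "finite Z" "Y \<subseteq> S" "Z \<subseteq> S" "finite (D \<one> ` generate G Y)"
  shows "finite (D \<one> ` generate G (Y \<union> Z)) \<and>
    card (D \<one> ` generate G (Y \<union> Z)) \<le> 2 ^ card Z * card (D \<one> ` generate G Y)"
  using assms(1,3)
proof (induction Z)
  case empty
  then show ?case using assms(4) by simp
next
  case (insert z Z)
  let ?A = "D \<one> ` generate G (Y \<union> Z)"
  have fin: "finite ?A" and card: "card ?A \<le> 2 ^ card Z * card (D \<one> ` generate G Y)"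
    using insert by auto
  have sub: "D \<one> ` generate G (Y \<union> insert z Z) \<subseteq> ?A \<union> (\<lambda>a. a + D \<one> z) ` ?A"
    using D_generate_insert[of "Y \<union> Z" z] insert.prems assms(2) by auto
  have "card (D \<one> ` generate G (Y \<union> insert z Z)) \<le> card (?A \<union> (\<lambda>a. a + D \<one> z) ` ?A)"
    using sub fin by (intro card_mono) auto
  also have "\<dots> \<le> card ?A + card ((\<lambda>a. a + D \<one> z) ` ?A)" by (rule card_Un_le)
  also have "\<dots> \<le> 2 * card ?A" using card_image_le[OF fin] by simp
  finally show ?case
    using sub fin card insert.hyps finite_subset[OF sub] by simp
qed

lemma D_generate_finite:
  assumes "finite Z" "Z \<subseteq> S"
  shows "finite (D \<one> ` generate G Z)"
  using D_generate_Un[OF assms(1) _ assms(2), of "{}"] by (simp add: generate_empty)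

end

section \<open>A growth criterion for finite generation\<close>

context group
begin

text \<open>\<open>D\<close> and \<open>E\<close> compute the mod 2 homology of \<open>L\<close> and
  \<open>K\<close>. The spans \<open>A n\<close> of the generators \<open>Y n\<close> exhaust the
  homology of \<open>L\<close>, and \<open>u - 1\<close> maps \<open>A n\<close> injectively onto a
  set \<open>A' n\<close> inside \<open>A (n + c)\<close>, which is at most \<open>2 ^ C\<close>
  times as large. So the cokernel of \<open>u - 1\<close> is finite. Conjugation by \<open>z\<close>
  in \<open>u_Y\<close> is allowed since homology does not see it.\<close>

lemma fin_gen_of_growth:
  fixes Y :: "nat \<Rightarrow> 'a set"
  assumes free: "free_on G B" and L: "subgroup L G" and K: "subgroup K G" and LK: "L \<subseteq> K"
    and u: "u \<in> K" "u <# L = L #> u" "\<And>n::nat. u [^] n \<in> L \<Longrightarrow> n = 0"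
    and K_eq: "\<And>k. k \<in> K \<Longrightarrow> \<exists>l\<in>L. \<exists>n::int. k = l \<otimes> u [^] n"
    and Y: "\<And>n. finite (Y n)" "mono Y" "\<And>n. Y n \<subseteq> L" "L \<subseteq> (\<Union>n. generate G (Y n))"
    and growth: "\<And>n. card (Y (n + c) - Y n) \<le> C"
    and u_Y: "\<And>n x. x \<in> Y n \<Longrightarrow>
      \<exists>z\<in>L. z \<otimes> (u \<otimes> x \<otimes> inv u) \<otimes> inv z \<in> generate G (Y (n + c))"
  obtains Z where "finite Z" "Z \<subseteq> K" "generate G Z = K"
proof -
  obtain D where "edge_cocycle G B L D" using edge_cocycle_exists free L by blast
  then interpret D: edge_cocycle G B L D .
  obtain E where "edge_cocycle G B K E" using edge_cocycle_exists free K by blast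
  then interpret E: edge_cocycle G B K E .
  have uG: "u \<in> carrier G" using u(1) E.S_subset by blast
  have LG: "x \<in> carrier G" if "x \<in> L" for x using that D.S_subset by blast
  have L_mult: "x \<otimes> y \<in> L" if "x \<in> L" "y \<in> L" for x y using that L by (simp add: subgroup.m_closed)
  have L_inv: "inv x \<in> L" if "x \<in> L" for x using that L by (simp add: subgroup.m_inv_closed)
  have conj: "u \<otimes> x \<otimes> inv u \<in> L" if "x \<in> L" for x
  proof -
    have "u \<otimes> x \<in> L #> u" using that u(2) by (auto simp: l_coset_def)
    then obtain y where "y \<in> L" "u \<otimes> x = y \<otimes> u" by (auto simp: r_coset_def)
    then show ?thesis using uG LG by (simp add: m_assoc)
  qed
  \<comment> \<open>\<open>q\<close> is \<open>u - 1\<close> applied to the class of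
    \<open>x\<close>; modulo 2 the difference is a sum.\<close>
  define q where "q x = D u x + D \<one> x" for x
  have q_mult: "q (x \<otimes> y) = q x + q y" if "x \<in> L" "y \<in> L" for x y
  proof -
    have "u \<otimes> x = (u \<otimes> x \<otimes> inv u) \<otimes> u" using uG LG[OF that(1)] by (simp add: m_assoc)
    then have "D (u \<otimes> x) y = D u y"
      using D.D_left[OF LG[OF that(2)] uG conj[OF that(1)]] by simp
    then have "D u (x \<otimes> y) = D u x + D u y"
      using that uG LG by (simp add: D.D_mult)
    then have "q (x \<otimes> y) = (D u x + D u y) + (D \<one> x + D \<one> y)"
      using D.D_hom[OF that] by (simp add: q_def)
    then show ?thesis unfolding q_def by (simp only: ac_simps)
  qed
  have q_one: "q \<one> = 0" using uG by (simp add: q_def)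
  have q_inv: "q (inv x) = q x" if "x \<in> L" for x
    using q_mult[OF that L_inv[OF that]] q_one LG[OF that] by (simp add: bit_fun_add_eq_0_iff)
  \<comment> \<open>The image of \<open>u - 1\<close> consists of classes of commutators with
    \<open>u\<close>, which become trivial in the homology of \<open>K\<close>.\<close>
  have q_comm: "q x = D \<one> (u \<otimes> x \<otimes> inv u \<otimes> inv x)" if "x \<in> L" for x
    using that uG conj L_inv by (simp add: q_def D.D_hom D.D_conj D.D_hom_inv)
  have q_zero: "D \<one> x = 0" if "x \<in> L" "q x = 0" for x
    using D.D_fixed_imp_zero[OF uG u(2,3) LG[OF that(1)]] that(2)
    by (simp add: q_def bit_fun_add_eq_0_iff)

  define W where "W n = generate G (Y n)" for n
  have WL: "W n \<subseteq> L" for n unfolding W_def using generate_subgroup_incl[OF Y(3) L] .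
  have YG: "Y n \<subseteq> carrier G" for n using Y(3) LG by blast
  have W_sub: "subgroup (W n) G" for n unfolding W_def using generate_is_subgroup[OF YG] .
  have W_mono: "mono W" unfolding W_def by (intro monoI mono_generate monoD[OF Y(2)])
  define A where "A n = D \<one> ` W n" for n
  define A' where "A' n = q ` W n" for n
  have finA: "finite (A n)" for n
    unfolding A_def W_def using D.D_generate_finite Y by blast
  have add: "a + b \<in> A n" if "a \<in> A n" "b \<in> A n" for a b n
  proof -
    obtain x y where "x \<in> W n" "y \<in> W n" "a = D \<one> x" "b = D \<one> y"
      using \<open>a \<in> A n\<close> \<open>b \<in> A n\<close> unfolding A_def by blast
    moreover from this have "D \<one> (x \<otimes> y) = D \<one> x + D \<one> y"
      using WL by (intro D.D_hom) auto
    moreover have "x \<otimes> y \<in> W n"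
      using calculation(1,2) W_sub subgroup.m_closed by metis
    ultimately show ?thesis unfolding A_def by (metis image_eqI)
  qed
  have diff: "a - b \<in> A' n" if "a \<in> A' n" "b \<in> A' n" for a b n
  proof -
    obtain x y where xy: "x \<in> W n" "y \<in> W n" "a = q x" "b = q y"
      using \<open>a \<in> A' n\<close> \<open>b \<in> A' n\<close> unfolding A'_def by blast
    have "a - b = a + - b" by (rule diff_conv_add_uminus)
    then have "a - b = q (x \<otimes> inv y)"
      using q_mult q_inv xy WL L_inv by (simp add: subset_eq)
    moreover have "x \<otimes> inv y \<in> W n"
      using xy W_sub subgroup.m_closed subgroup.m_inv_closed by metis
    ultimately show ?thesis unfolding A'_def by blast
  qed
  have "q x \<in> A (n + c)" if "x \<in> W n" for x n
    using that unfolding W_def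
  proof induction
    case one
    have "\<one> \<in> W (n + c)" using W_sub subgroup.one_closed by blast
    then show ?case using q_one D.D_one[OF one_closed] unfolding A_def by (metis image_eqI)
  next
    have *: "q x \<in> A (n + c)" if x: "x \<in> Y n" for x
    proof -
      have xL: "x \<in> L" using x Y(3) by blast
      obtain z where z: "z \<in> L" "z \<otimes> (u \<otimes> x \<otimes> inv u) \<otimes> inv z \<in> W (n + c)"
        using u_Y[OF x] unfolding W_def by blast
      let ?v = "u \<otimes> x \<otimes> inv u"
      have v: "?v \<in> L" using conj[OF xL] .
      \<comment> \<open>Both \<open>z\<close> and \<open>?v\<close> lie in \<open>L\<close>, so
        conjugation by \<open>z\<close> only adds \<open>D \<one> z\<close> twice.\<close>
      have "D \<one> (z \<otimes> ?v \<otimes> inv z) = D \<one> z + D \<one> ?v + D \<one> z"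
        using z v L_mult L_inv by (simp add: D.D_hom D.D_hom_inv)
      also have "\<dots> = (D \<one> z + D \<one> z) + D \<one> ?v" by (simp only: ac_simps)
      also have "\<dots> = D u x" using D.D_conj[OF xL uG v] by simp
      finally have "D u x \<in> A (n + c)" using z(2) unfolding A_def by (metis image_eqI)
      moreover have "x \<in> W (n + c)"
        using subsetD[OF monoD[OF Y(2), of n "n + c"] x] by (simp add: W_def generate.incl)
      then have "D \<one> x \<in> A (n + c)" unfolding A_def by blast
      ultimately show ?thesis unfolding q_def by (rule add)
    qed
    {
      case (incl x)
      then show ?case by (rule *)
    next
      case (inv x)
      then show ?case using * q_inv Y(3) by (metis subsetD)
    }
  next
    case (eng x y)
    then have "x \<in> L" "y \<in> L" using WL unfolding W_def by blast+
    then have "q (x \<otimes> y) = q x + q y" by (rule q_mult)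
    then show ?case using add[OF eng.IH] by (simp only:)
  qed
  then have sub: "A' n \<subseteq> A (n + c)" for n unfolding A'_def by blast
  have finA': "finite (A' n)" for n using sub finA finite_subset by blast
  \<comment> \<open>By injectivity of \<open>u - 1\<close>, the value \<open>q x\<close> determines
    \<open>D \<one> x\<close>; so \<open>A n\<close> is an image of \<open>A' n\<close>.\<close>
  have card_le: "card (A n) \<le> card (A' n)" for n
  proof -
    have "D \<one> x = D \<one> y" if "x \<in> W n" "y \<in> W n" "q x = q y" for x y
    proof -
      have xy: "x \<in> L" "y \<in> L" using that WL by auto
      then have "q (x \<otimes> inv y) = 0" using that by (simp add: q_mult q_inv L_inv)
      then have "D \<one> (x \<otimes> inv y) = 0" using xy by (simp add: q_zero L_mult L_inv)
      then show ?thesis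
        using xy by (simp add: D.D_hom D.D_hom_inv L_inv bit_fun_add_eq_0_iff)
    qed
    then have "D \<one> x = D \<one> (inv_into (W n) q (q x))" if "x \<in> W n" for x
      using that by (metis f_inv_into_f image_eqI inv_into_into)
    then have "A n \<subseteq> (\<lambda>v. D \<one> (inv_into (W n) q v)) ` A' n"
      unfolding A_def A'_def by auto
    then show ?thesis using finA' by (meson card_image_le card_mono finite_imageI le_trans)
  qed
  have "card (A (n + c)) \<le> 2 ^ C * card (A' n)" for n
  proof -
    have "Y n \<union> (Y (n + c) - Y n) = Y (n + c)" using monoD[OF Y(2), of n "n + c"] by auto
    then have "card (A (n + c)) \<le> 2 ^ card (Y (n + c) - Y n) * card (A n)"
      using D.D_generate_Un[of "Y (n + c) - Y n" "Y n"] Y finA[of n]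
      unfolding A_def W_def by (metis Diff_subset dual_order.trans finite_Diff)
    also have "\<dots> \<le> 2 ^ C * card (A' n)"
      using growth[of n] card_le[of n] by (intro mult_mono power_increasing) auto
    finally show ?thesis .
  qed
  moreover have "0 \<in> A' n" for n
    using q_one W_sub[of n] subgroup.one_closed unfolding A'_def by (metis image_eqI)
  moreover have "mono A"
    unfolding A_def using W_mono by (auto simp: mono_def)
  ultimately obtain T where T: "finite T" "T \<subseteq> (\<Union>n. A n)"
      "\<And>a. a \<in> (\<Union>n. A n) \<Longrightarrow> \<exists>t\<in>T. a - t \<in> (\<Union>n. A' n)"
    using finite_cokernel_of_growth[of A A' c "2 ^ C"] finA add diff sub by metis
  have LW: "L = (\<Union>n. W n)" using Y(4) WL unfolding W_def by blast
  have UA: "(\<Union>n. A n) = D \<one> ` L" "(\<Union>n. A' n) = q ` L"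
    unfolding LW A_def A'_def by auto
  obtain T0 where T0: "finite T0" "T0 \<subseteq> L" "T = D \<one> ` T0"
    using T(1,2) UA finite_subset_image by metis

  \<comment> \<open>Modulo the image of \<open>u - 1\<close> the class of \<open>l\<close> is that
    of some \<open>t\<close> in \<open>T0\<close>. The difference is the class of a commutator, so
    \<open>l\<close> and \<open>t\<close> have the same class in \<open>K\<close>.\<close>
  have E_L: "E \<one> l \<in> E \<one> ` T0" if l: "l \<in> L" for l
  proof -
    have "D \<one> l \<in> (\<Union>n. A n)" using l UA by blast
    then obtain t where "t \<in> T0" "D \<one> l - D \<one> t \<in> q ` L"
      using T(3)[of "D \<one> l"] T0 UA(2) by auto
    then obtain m where t: "t \<in> T0" and m: "m \<in> L" and eq: "D \<one> l - D \<one> t = q m" by blast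
    have tL: "t \<in> L" using t T0 by blast
    let ?w = "u \<otimes> m \<otimes> inv u \<otimes> inv m"
    have w: "?w \<in> L" using conj m L_inv L_mult by simp
    have "D \<one> l = D \<one> t + D \<one> ?w" using eq q_comm[OF m] by (simp add: diff_eq_eq add.commute)
    then have "D \<one> (l \<otimes> inv (t \<otimes> ?w)) = 0"
      using l tL w L_mult L_inv by (simp add: D.D_hom D.D_hom_inv)
    then have "E \<one> (l \<otimes> inv (t \<otimes> ?w)) = 0"
      using D_zero_mono[OF D.edge_cocycle_axioms E.edge_cocycle_axioms LK, of _ \<one>] l tL w LG by simp
    then have "E \<one> l = E \<one> t + E \<one> ?w"
      using l tL w L_mult L_inv LK subsetD[OF LK]
      by (simp add: E.D_hom E.D_hom_inv bit_fun_add_eq_0_iff)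
    moreover have "E \<one> ?w = 0"
    proof -
      have K': "m \<in> K" "inv u \<in> K" "inv m \<in> K" "u \<otimes> m \<in> K" "u \<otimes> m \<otimes> inv u \<in> K"
        using m u(1) LK K subgroup.m_closed subgroup.m_inv_closed by (metis subsetD)+
      have "E \<one> ?w = E \<one> u + E \<one> m + E \<one> u + E \<one> m"
        using K' u(1) by (simp add: E.D_hom E.D_hom_inv)
      also have "\<dots> = (E \<one> u + E \<one> u) + (E \<one> m + E \<one> m)" by (simp only: ac_simps)
      finally show ?thesis by simp
    qed
    ultimately show ?thesis using t by simp
  qed
  \<comment> \<open>Besides the finitely many classes from \<open>L\<close>, the factor
    \<open>u [^] n\<close> contributes only \<open>0\<close> or the class of
    \<open>u\<close>.\<close>
  have "E \<one> ` K \<subseteq> (\<lambda>(a, b). a + b) ` (E \<one> ` T0 \<times> {0, E \<one> u})"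
  proof
    fix v assume "v \<in> E \<one> ` K"
    then obtain k where k: "k \<in> K" "v = E \<one> k" by blast
    then obtain l and n :: int where l: "l \<in> L" "k = l \<otimes> u [^] n" using K_eq by blast
    have "u [^] n \<in> K" using u(1) K subgroup_int_pow_closed by blast
    then have "v = E \<one> l + E \<one> (u [^] n)" using k l LK by (auto intro: E.D_hom)
    then show "v \<in> (\<lambda>(a, b). a + b) ` (E \<one> ` T0 \<times> {0, E \<one> u})"
      using E_L[OF l(1)] E.D_hom_int_pow[OF u(1), of n] by blast
  qed
  then have "finite (E \<one> ` K)" by (rule finite_subset) (use T0(1) in auto)
  then show thesis using E.finite_cycles_imp_fin_gen that by blast
qed

end

section \<open>Kernels of integer characters\<close>

text \<open>Characters of \<open>H\<close> are functions on the ambient group, so that several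
  characters and their kernels can be compared inside one group.\<close>

locale int_character = group G for G (structure) +
  fixes H and \<alpha> :: "'a \<Rightarrow> int"
  assumes subgroup_H: "subgroup H G"
    and char_mult: "\<lbrakk>x \<in> H; y \<in> H\<rbrakk> \<Longrightarrow> \<alpha> (x \<otimes> y) = \<alpha> x + \<alpha> y"
begin

lemma H_closed [simp]: "x \<in> H \<Longrightarrow> x \<in> carrier G"
  using subgroup_H subgroup.mem_carrier by metis

lemma char_one [simp]: "\<alpha> \<one> = 0"
  using char_mult[of \<one> \<one>] subgroup_H by (simp add: subgroup.one_closed)

lemma char_inv [simp]: "x \<in> H \<Longrightarrow> \<alpha> (inv x) = - \<alpha> x"
  using char_mult[of x "inv x"] subgroup_H by (simp add: subgroup.m_inv_closed)

lemma int_pow_in_H: "x \<in> H \<Longrightarrow> x [^] (k::int) \<in> H"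
  using subgroup_int_pow_closed[OF subgroup_H] .

lemma char_int_pow [simp]:
  assumes "x \<in> H"
  shows "\<alpha> (x [^] (k::int)) = k * \<alpha> x"
proof -
  have S_pow: "x [^] n \<in> H" for n :: nat
    using int_pow_in_H[OF assms, of "int n"] by (simp add: int_pow_int)
  have nat: "\<alpha> (x [^] n) = int n * \<alpha> x" for n :: nat
    by (induction n) (use assms S_pow in \<open>simp_all add: char_mult algebra_simps\<close>)
  show ?thesis
    by (cases k rule: int_cases2) (use nat assms S_pow in \<open>simp_all add: int_pow_int int_pow_neg_int\<close>)
qed

lemma subgroup_kernel: "subgroup {h \<in> H. \<alpha> h = 0} G"
  by (rule subgroupI)
    (use subgroup_H in \<open>auto simp: char_mult subgroup.m_closed subgroup.m_inv_closed
      intro: subgroup.one_closed exI[of _ \<one>]\<close>)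

text \<open>The image of \<open>N\<close> is a subgroup of the integers, hence cyclic: an element
  with least nonzero absolute value generates it by division with remainder. If the image is zero,
  \<open>y = \<one>\<close> serves.\<close>

lemma char_generator:
  assumes N: "subgroup N G" "N \<subseteq> H"
  obtains y where "y \<in> N" "\<And>x. x \<in> N \<Longrightarrow> \<alpha> y dvd \<alpha> x"
proof (cases "\<forall>x\<in>N. \<alpha> x = 0")
  case True
  then show thesis using that[of \<one>] N(1) by (simp add: subgroup.one_closed)
next
  case False
  then obtain y where y: "y \<in> N" "\<alpha> y \<noteq> 0"
    and min: "\<And>x. \<lbrakk>x \<in> N; \<alpha> x \<noteq> 0\<rbrakk> \<Longrightarrow> nat \<bar>\<alpha> y\<bar> \<le> nat \<bar>\<alpha> x\<bar>"
    using ex_has_least_nat[of "\<lambda>x. x \<in> N \<and> \<alpha> x \<noteq> 0" _ "\<lambda>x. nat \<bar>\<alpha> x\<bar>"] by blast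
  have "\<alpha> y dvd \<alpha> x" if x: "x \<in> N" for x
  proof -
    let ?r = "x \<otimes> y [^] (- (\<alpha> x div \<alpha> y))"
    have yp: "y [^] (- (\<alpha> x div \<alpha> y)) \<in> N"
      using y(1) subgroup_int_pow_closed[OF N(1)] by blast
    then have r: "?r \<in> N" using x N(1) by (simp add: subgroup.m_closed)
    have "\<alpha> ?r = \<alpha> x - (\<alpha> x div \<alpha> y) * \<alpha> y"
      using x y yp N(2) by (simp add: char_mult subset_eq)
    then have \<alpha>r: "\<alpha> ?r = \<alpha> x mod \<alpha> y" by (simp add: minus_div_mult_eq_mod)
    then have "\<bar>\<alpha> ?r\<bar> < \<bar>\<alpha> y\<bar>" using y(2) by (simp add: abs_mod_less)
    then have "\<alpha> ?r = 0" using min[OF r] by linarith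
    then show ?thesis using \<alpha>r by (simp add: dvd_eq_mod_eq_0)
  qed
  then show thesis using that y(1) by blast
qed

end

section \<open>Conjugation, and two characters on one subgroup\<close>

context group
begin

lemma inv_mult_cancel_left:
  assumes "x \<in> carrier G" "y \<in> carrier G"
  shows "inv x \<otimes> (x \<otimes> y) = y" "x \<otimes> (inv x \<otimes> y) = y"
  using assms by (simp_all add: m_assoc[symmetric])

lemma conj_mult:
  "\<lbrakk>g \<in> carrier G; x \<in> carrier G; y \<in> carrier G\<rbrakk> \<Longrightarrow>
     g \<otimes> (x \<otimes> y) \<otimes> inv g = (g \<otimes> x \<otimes> inv g) \<otimes> (g \<otimes> y \<otimes> inv g)"
  by (simp add: m_assoc inv_solve_left)

lemma conj_generate:
  assumes "g \<in> carrier G" "A \<subseteq> carrier G" "x \<in> generate G A"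
  shows "g \<otimes> x \<otimes> inv g \<in> generate G ((\<lambda>a. g \<otimes> a \<otimes> inv g) ` A)"
  using assms(3)
proof induction
  case one
  then show ?case using assms(1) by (simp add: generate.one)
next
  case (incl a)
  then show ?case by (simp add: generate.incl)
next
  case (inv a)
  then have "g \<otimes> inv a \<otimes> inv g = inv (g \<otimes> a \<otimes> inv g)"
    using assms by (auto simp: inv_mult_group m_assoc)
  then show ?case using inv by (auto intro: generate.inv)
next
  case (eng x y)
  then have "x \<in> carrier G" "y \<in> carrier G" using assms(2) generate_in_carrier by auto
  then show ?case using eng assms(1) by (simp add: conj_mult generate.eng)
qed

text \<open>\<open>\<alpha>\<close> has kernel \<open>K = H \<inter> F\<close>, and
  \<open>\<beta>\<close> has the finitely generated kernel \<open>N\<close>. If one kernel contains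
  the other, generators of \<open>K\<close> are explicit. Otherwise the growth criterion applies to
  \<open>L = K \<inter> N\<close>, generated by conjugates of a finite set under powers of
  \<open>y\<close>.\<close>

lemma kernel_in_free_fin_gen:
  assumes F: "subgroup F G" and free: "free_on (G\<lparr>carrier := F\<rparr>) B"
    and \<alpha>: "int_character G H \<alpha>" and \<beta>: "int_character G H \<beta>"
    and \<alpha>_F: "\<And>h. h \<in> H \<Longrightarrow> h \<in> F \<longleftrightarrow> \<alpha> h = 0"
    and s: "s \<in> H" "\<beta> s \<noteq> 0"
    and P: "finite P" "generate G P = {h \<in> H. \<beta> h = 0}"
  obtains Z where "finite Z" "Z \<subseteq> H \<inter> F" "generate G Z = H \<inter> F"
proof -
  interpret \<alpha>: int_character G H \<alpha> by fact
  interpret \<beta>: int_character G H \<beta> by fact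
  define K where "K = {h \<in> H. \<alpha> h = 0}"
  define N where "N = {h \<in> H. \<beta> h = 0}"
  define L where "L = K \<inter> N"
  have K_eq: "H \<inter> F = K" using \<alpha>_F by (auto simp: K_def)
  have N_gen: "generate G P = N" using P(2) by (simp add: N_def)
  have PN: "P \<subseteq> N" using N_gen generate.incl by fastforce
  have K: "subgroup K G" unfolding K_def by (rule \<alpha>.subgroup_kernel)
  have N: "subgroup N G" unfolding N_def by (rule \<beta>.subgroup_kernel)
  have L: "subgroup L G" unfolding L_def using K N by (rule subgroups_Inter_pair)
  have KH: "K \<subseteq> H" and NH: "N \<subseteq> H" by (auto simp: K_def N_def)
  note H = \<alpha>.subgroup_H
  have Hm: "x \<otimes> y \<in> H" if "x \<in> H" "y \<in> H" for x y using that H by (simp add: subgroup.m_closed)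
  have Hi: "inv x \<in> H" if "x \<in> H" for x using that H by (simp add: subgroup.m_inv_closed)
  obtain y where y: "y \<in> N" and y_dvd: "\<And>x. x \<in> N \<Longrightarrow> \<alpha> y dvd \<alpha> x"
    using \<alpha>.char_generator[OF N NH] by blast
  obtain u where u: "u \<in> K" and u_dvd: "\<And>x. x \<in> K \<Longrightarrow> \<beta> u dvd \<beta> x"
    using \<beta>.char_generator[OF K KH] by blast
  have uH: "u \<in> H" and yH: "y \<in> H" using u y KH NH by auto
  have K_split: "\<exists>l\<in>L. \<exists>n::int. k = l \<otimes> u [^] n" if k: "k \<in> K" for k
  proof -
    obtain n where n: "\<beta> k = \<beta> u * n" using u_dvd[OF k] by (elim dvdE)
    have kH: "k \<in> H" and up: "u [^] n \<in> H" using k uH KH \<alpha>.int_pow_in_H by auto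
    have "k \<otimes> inv (u [^] n) \<in> L"
      using k u n kH up uH Hm Hi by (simp add: L_def K_def N_def \<alpha>.char_mult \<beta>.char_mult)
    moreover have "k = (k \<otimes> inv (u [^] n)) \<otimes> u [^] n"
      using kH up by (simp add: m_assoc)
    ultimately show ?thesis by blast
  qed
  \<comment> \<open>\<open>\<alpha> y = 0\<close> means that \<open>N\<close> lies in
    \<open>K\<close>, and \<open>\<beta> u = 0\<close> that \<open>K\<close> lies in
    \<open>N\<close>; in the third case neither contains the other.\<close>
  consider "\<alpha> y = 0" | "\<beta> u = 0" | "\<alpha> y \<noteq> 0" "\<beta> u \<noteq> 0" by blast
  then show thesis
  proof cases
    case 1
    then have NK: "N \<subseteq> K" using y_dvd NH by (auto simp: K_def)
    have "K \<subseteq> generate G (insert u P)"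
    proof
      fix k assume "k \<in> K"
      then obtain l and n :: int where l: "l \<in> L" "k = l \<otimes> u [^] n" using K_split by blast
      have sub: "insert u P \<subseteq> carrier G" using PN NH uH by auto
      have "l \<in> generate G P" using l N_gen by (simp add: L_def)
      then have "l \<in> generate G (insert u P)" using mono_generate[of P "insert u P"] by auto
      moreover have "u [^] n \<in> generate G (insert u P)"
        using subgroup_int_pow_closed[OF generate_is_subgroup[OF sub]] by (simp add: generate.incl)
      ultimately show "k \<in> generate G (insert u P)" using l(2) by (simp add: generate.eng)
    qed
    moreover have uP: "insert u P \<subseteq> K" using u PN NK by auto
    ultimately have "generate G (insert u P) = K"
      using generate_subgroup_incl[OF _ K] by blast
    then show thesis using that[of "insert u P"] P(1) uP K_eq by auto
  next
    case 2
    then have KN: "K \<subseteq> N" using u_dvd KH by (auto simp: N_def)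
    have "N \<subseteq> K"
    proof
      fix n assume n: "n \<in> N"
      then have nH: "n \<in> H" using NH by auto
      have p: "s [^] \<alpha> n \<in> H" "n [^] (- \<alpha> s) \<in> H" using s nH \<alpha>.int_pow_in_H by auto
      \<comment> \<open>The exponents are balanced so that \<open>\<alpha>\<close> vanishes on the
        product, while \<open>\<beta>\<close> takes the value \<open>\<alpha> n * \<beta> s\<close>
        there.\<close>
      then have "s [^] \<alpha> n \<otimes> n [^] (- \<alpha> s) \<in> K"
        using s nH Hm by (simp add: K_def \<alpha>.char_mult)
      then have "\<beta> (s [^] \<alpha> n \<otimes> n [^] (- \<alpha> s)) = 0" using KN by (auto simp: N_def)
      then have "\<alpha> n * \<beta> s = 0" using p s nH n by (simp add: \<beta>.char_mult N_def)
      then show "n \<in> K" using s nH by (simp add: K_def)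
    qed
    then have "N = K" using KN by blast
    then show thesis using that[of P] P(1) PN N_gen K_eq by simp
  next
    case 3
    have yG: "y \<in> carrier G" and uG: "u \<in> carrier G" using yH uH by auto
    have LH: "L \<subseteq> H" using KH by (auto simp: L_def)
    have LG: "x \<in> carrier G" if "x \<in> L" for x using that LH by auto
    have L_iff: "x \<in> L \<longleftrightarrow> x \<in> H \<and> \<alpha> x = 0 \<and> \<beta> x = 0" for x by (auto simp: L_def K_def N_def)
    have L_conj: "g \<otimes> x \<otimes> inv g \<in> L" if "g \<in> H" "x \<in> L" for g x
      using that Hm Hi by (simp add: L_iff \<alpha>.char_mult \<beta>.char_mult)
    \<comment> \<open>Dividing a generator \<open>p\<close> of \<open>N\<close> by the right power
      of \<open>y\<close> moves it into \<open>L\<close>.\<close>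
    define e where "e p = \<alpha> p div \<alpha> y" for p
    define Y0 where "Y0 = (\<lambda>p. p \<otimes> y [^] (- e p)) ` P"
    have e: "\<alpha> p = e p * \<alpha> y" if "p \<in> N" for p using y_dvd[OF that] by (simp add: e_def)
    have ypH: "y [^] (k::int) \<in> H" for k using yH by (rule \<alpha>.int_pow_in_H)
    have ypG [simp]: "y [^] (k::int) \<in> carrier G" for k using yG by simp
    have \<beta>y: "\<beta> y = 0" using y by (simp add: N_def)
    have Y0L: "Y0 \<subseteq> L"
      unfolding Y0_def
    proof clarify
      fix p assume "p \<in> P"
      then have p: "p \<in> N" "p \<in> H" using PN NH by auto
      then have "\<beta> p = 0" by (simp add: N_def)
      then show "p \<otimes> y [^] (- e p) \<in> L"
        using p e[OF p(1)] ypH yH \<beta>y Hm by (simp add: L_iff \<alpha>.char_mult \<beta>.char_mult)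
    qed
    define cj where "cj j x = y [^] j \<otimes> x \<otimes> inv (y [^] j)" for j :: int and x
    \<comment> \<open>The window of exponents has \<open>2 * n + 1\<close> elements, which makes the
      growth linear.\<close>
    define Y where "Y n = (\<lambda>(j, x). cj j x) ` ({- int n..int n} \<times> Y0)" for n :: nat
    have finY0: "finite Y0" using P(1) by (simp add: Y0_def)
    have finY: "finite (Y n)" for n using finY0 by (simp add: Y_def)
    have monoY: "mono Y" by (rule monoI) (force simp: Y_def)
    have cjL: "cj j x \<in> L" if "x \<in> L" for j x
      unfolding cj_def using L_conj[OF ypH that] .
    have YL: "Y n \<subseteq> L" for n using Y0L cjL by (auto simp: Y_def)
    have YG: "Y n \<subseteq> carrier G" for n using YL LG by blast
    have cj_cj: "cj i (cj j x) = cj (i + j) x" if "x \<in> L" for i j x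
      using LG[OF that] yG by (simp add: cj_def int_pow_mult inv_mult_group m_assoc)
    have cj_W: "cj i x \<in> generate G (Y (n + nat \<bar>i\<bar>))" if x: "x \<in> generate G (Y n)" for i x n
    proof -
      have "cj i x \<in> generate G ((\<lambda>a. cj i a) ` Y n)"
        unfolding cj_def using conj_generate[OF ypG YG x] .
      moreover have "(\<lambda>a. cj i a) ` Y n \<subseteq> Y (n + nat \<bar>i\<bar>)"
      proof clarify
        fix a assume "a \<in> Y n"
        then obtain j x where j: "- int n \<le> j" "j \<le> int n" "x \<in> Y0" "a = cj j x"
          by (auto simp: Y_def)
        then have "cj i a = cj (i + j) x" using cj_cj Y0L by auto
        then show "cj i a \<in> Y (n + nat \<bar>i\<bar>)"
          using j by (auto simp: Y_def intro!: image_eqI[of _ _ "(i + j, x)"])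
      qed
      ultimately show ?thesis using mono_generate by blast
    qed
    define V where "V = (\<Union>n. generate G (Y n))"
    have W_mono: "generate G (Y m) \<subseteq> generate G (Y n)" if "m \<le> n" for m n
      using mono_generate monoD[OF monoY that] by blast
    have V_mult: "a \<otimes> b \<in> V" if "a \<in> V" "b \<in> V" for a b
    proof -
      obtain m n where "a \<in> generate G (Y m)" "b \<in> generate G (Y n)"
        using \<open>a \<in> V\<close> \<open>b \<in> V\<close> by (auto simp: V_def)
      then have "a \<in> generate G (Y (max m n))" "b \<in> generate G (Y (max m n))"
        using W_mono[of m "max m n"] W_mono[of n "max m n"] by auto
      then show ?thesis unfolding V_def by (blast intro: generate.eng)
    qed
    have V_inv: "inv a \<in> V" if "a \<in> V" for a
      using that generate_m_inv_closed[OF YG] by (auto simp: V_def)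
    have V_cj: "cj i a \<in> V" if "a \<in> V" for i a
      using that cj_W by (auto simp: V_def)
    have VL: "V \<subseteq> L" using generate_subgroup_incl[OF YL L] by (auto simp: V_def)
    \<comment> \<open>\<open>V\<close> is stable under conjugation by powers of \<open>y\<close>, so
      products and inverses of elements of this form can be brought back to it. Hence
      \<open>N\<close> is \<open>V\<close> times the powers of \<open>y\<close>; as
      \<open>\<alpha> y\<close> is nonzero, \<open>L\<close> has exponent zero and equals
      \<open>V\<close>.\<close>
    have "\<exists>a\<in>V. \<exists>k::int. x = a \<otimes> y [^] k" if "x \<in> generate G P" for x
      using that
    proof induction
      case one
      have "\<one> \<in> V" by (auto simp: V_def generate.one)
      then show ?case by (intro bexI[of _ \<one>] exI[of _ 0]) auto
    next
      have base: "p \<otimes> y [^] (- e p) \<in> V \<and> p = (p \<otimes> y [^] (- e p)) \<otimes> y [^] e p" if p: "p \<in> P" for p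
      proof
        have pG: "p \<in> carrier G" using p PN NH by auto
        have p0: "p \<otimes> y [^] (- e p) \<in> Y0" using p by (simp add: Y0_def)
        then have "p \<otimes> y [^] (- e p) = cj 0 (p \<otimes> y [^] (- e p))"
          using Y0L LG by (auto simp: cj_def)
        then have "p \<otimes> y [^] (- e p) \<in> Y 0" using p0 unfolding Y_def by force
        then show "p \<otimes> y [^] (- e p) \<in> V" by (auto simp: V_def intro: generate.incl)
        show "p = (p \<otimes> y [^] (- e p)) \<otimes> y [^] e p"
          using pG yG by (simp add: m_assoc int_pow_mult[symmetric])
      qed
      {
        case (incl p)
        then show ?case using base by blast
      next
        case (inv p)
        let ?a = "p \<otimes> y [^] (- e p)"
        have a: "?a \<in> V" and p: "p = ?a \<otimes> y [^] e p" using base[OF inv] by auto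
        have aL: "?a \<in> L" using a VL by blast
        have "inv p = inv (?a \<otimes> y [^] e p)" using p by simp
        also have "\<dots> = cj (- e p) (inv ?a) \<otimes> y [^] (- e p)"
          using LG[OF aL] yG by (simp add: cj_def inv_mult_group m_assoc int_pow_neg)
        finally have "inv p = cj (- e p) (inv ?a) \<otimes> y [^] (- e p)" .
        then show ?case using V_cj[OF V_inv[OF a]] by blast
      }
    next
      case (eng x z)
      then obtain a b and k m :: int where ab: "a \<in> V" "x = a \<otimes> y [^] k" "b \<in> V" "z = b \<otimes> y [^] m"
        by blast
      have "a \<in> carrier G" "b \<in> carrier G" using ab VL LG by auto
      then have "x \<otimes> z = (a \<otimes> cj k b) \<otimes> y [^] (k + m)"
        using yG ab by (simp add: cj_def m_assoc int_pow_mult inv_solve_left)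
      then show ?case using V_mult[OF ab(1) V_cj[OF ab(3)]] by blast
    qed
    then have N_split: "\<exists>a\<in>V. \<exists>k::int. x = a \<otimes> y [^] k" if "x \<in> N" for x
      using that N_gen by simp
    have LV: "L \<subseteq> V"
    proof
      fix l assume l: "l \<in> L"
      then have "l \<in> N" by (simp add: L_def)
      then obtain a and k :: int where a: "a \<in> V" "l = a \<otimes> y [^] k"
        using N_split by blast
      have "a \<in> L" using a VL by blast
      then have "\<alpha> l = k * \<alpha> y" using a(2) yH ypH by (simp add: \<alpha>.char_mult L_iff)
      then have "k = 0" using l 3 by (simp add: L_iff)
      then show "l \<in> V" using a LG[OF \<open>a \<in> L\<close>] by simp
    qed
    \<comment> \<open>\<open>Y0\<close> is finite, so one window suffices for all its conjugates by
      \<open>u\<close>; its width \<open>c\<close> is the shift in the growth criterion.\<close>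
    have "\<exists>c. \<forall>x\<in>Y0. u \<otimes> x \<otimes> inv u \<in> generate G (Y c)"
    proof -
      have "\<forall>x\<in>Y0. \<exists>c. u \<otimes> x \<otimes> inv u \<in> generate G (Y c)"
        using L_conj[OF uH] Y0L LV by (auto simp: V_def subset_eq)
      then obtain f where f: "\<And>x. x \<in> Y0 \<Longrightarrow> u \<otimes> x \<otimes> inv u \<in> generate G (Y (f x))" by metis
      have "f x \<le> Max (f ` Y0)" if "x \<in> Y0" for x using that finY0 by simp
      then show ?thesis using f W_mono by (intro exI[of _ "Max (f ` Y0)"]) blast
    qed
    then obtain c where c: "\<And>x. x \<in> Y0 \<Longrightarrow> u \<otimes> x \<otimes> inv u \<in> generate G (Y c)" by blast
    have u_Y: "\<exists>z\<in>L. z \<otimes> (u \<otimes> x \<otimes> inv u) \<otimes> inv z \<in> generate G (Y (n + c))"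
      if x: "x \<in> Y n" for n x
    proof -
      obtain j a where j: "- int n \<le> j" "j \<le> int n" "a \<in> Y0" "x = cj j a"
        using x by (auto simp: Y_def)
      have aG: "a \<in> carrier G" using j(3) Y0L LG by blast
      \<comment> \<open>The commutator of \<open>y [^] j\<close> and \<open>u\<close> is killed by
        both characters, so it lies in \<open>L\<close>. Conjugating by it exchanges the order in
        which \<open>u\<close> and \<open>y [^] j\<close> act on \<open>a\<close>.\<close>
      let ?z = "y [^] j \<otimes> u \<otimes> inv (y [^] j) \<otimes> inv u"
      have "?z \<in> L"
        using ypH uH yH Hm Hi \<beta>y u by (simp add: L_iff \<alpha>.char_mult \<beta>.char_mult K_def)
      moreover have "?z \<otimes> (u \<otimes> x \<otimes> inv u) \<otimes> inv ?z = cj j (u \<otimes> a \<otimes> inv u)"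
        unfolding j(4) cj_def using aG uG ypG[of j]
        by (simp add: m_assoc inv_mult_group inv_mult_cancel_left)
      moreover have "cj j (u \<otimes> a \<otimes> inv u) \<in> generate G (Y (c + nat \<bar>j\<bar>))"
        using cj_W c j(3) by blast
      moreover have "c + nat \<bar>j\<bar> \<le> n + c" using j by auto
      then have "generate G (Y (c + nat \<bar>j\<bar>)) \<subseteq> generate G (Y (n + c))" by (rule W_mono)
      ultimately have "?z \<in> L" "?z \<otimes> (u \<otimes> x \<otimes> inv u) \<otimes> inv ?z \<in> generate G (Y (n + c))"
        by (auto simp only:)
      then show ?thesis by (rule bexI[rotated])
    qed
    \<comment> \<open>New conjugates have exponents \<open>j\<close> with
      \<open>n < \<bar>j\<bar> \<le> n + c\<close>: \<open>c\<close> values on either side,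
      independently of \<open>n\<close>.\<close>
    have growth: "card (Y (n + c) - Y n) \<le> card ({1..int c} \<times> Y0) + card ({1..int c} \<times> Y0)" for n
    proof -
      let ?f = "\<lambda>(j, x). cj (int n + j) x" and ?g = "\<lambda>(j, x). cj (- int n - j) x"
      have "Y (n + c) - Y n \<subseteq> ?f ` ({1..int c} \<times> Y0) \<union> ?g ` ({1..int c} \<times> Y0)"
      proof
        fix v assume v: "v \<in> Y (n + c) - Y n"
        then obtain j x where j: "- int (n + c) \<le> j" "j \<le> int (n + c)" "x \<in> Y0" "v = cj j x"
          by (auto simp: Y_def)
        have "\<not> (- int n \<le> j \<and> j \<le> int n)" using v j by (auto simp: Y_def)
        then consider "int n < j" | "j < - int n" by linarith
        then show "v \<in> ?f ` ({1..int c} \<times> Y0) \<union> ?g ` ({1..int c} \<times> Y0)"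
        proof cases
          case 1
          then have "v = ?f (j - int n, x)" "(j - int n, x) \<in> {1..int c} \<times> Y0" using j by auto
          then show ?thesis by blast
        next
          case 2
          then have "v = ?g (- int n - j, x)" "(- int n - j, x) \<in> {1..int c} \<times> Y0" using j by auto
          then show ?thesis by blast
        qed
      qed
      then have "card (Y (n + c) - Y n) \<le> card (?f ` ({1..int c} \<times> Y0) \<union> ?g ` ({1..int c} \<times> Y0))"
        using finY0 by (intro card_mono) auto
      also have "\<dots> \<le> card (?f ` ({1..int c} \<times> Y0)) + card (?g ` ({1..int c} \<times> Y0))"
        by (rule card_Un_le)
      also have "\<dots> \<le> card ({1..int c} \<times> Y0) + card ({1..int c} \<times> Y0)"
        using finY0 by (intro add_mono card_image_le) auto
      finally show ?thesis .
    qed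
    \<comment> \<open>The growth criterion needs a free ambient group. It is applied inside
      \<open>F\<close>, which contains \<open>K\<close>, \<open>L\<close> and \<open>u\<close> but
      in general not \<open>y\<close>; the data are restated there.\<close>
    let ?F = "G\<lparr>carrier := F\<rparr>"
    interpret F: group ?F using F by (rule subgroup_imp_group)
    have KF: "K \<subseteq> F" using K_eq by blast
    have LK: "L \<subseteq> K" by (simp add: L_def)
    have LF: "L \<subseteq> F" using LK KF by blast
    have uF: "u \<in> F" using u KF by blast
    have gen_F: "generate ?F A = generate G A" if "A \<subseteq> F" for A
      using generate_consistent[OF that F] .
    have inv_F: "inv\<^bsub>?F\<^esub> x = inv x" if "x \<in> F" for x using m_inv_consistent[OF F that] .
    have "u <# L = L #> u"
    proof
      show "u <# L \<subseteq> L #> u"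
      proof
        fix v assume "v \<in> u <# L"
        then obtain l where l: "l \<in> L" "v = u \<otimes> l" by (auto simp: l_coset_def)
        then have "v = (u \<otimes> l \<otimes> inv u) \<otimes> u" using uG LG by (simp add: m_assoc)
        then show "v \<in> L #> u" using L_conj[OF uH l(1)] by (auto simp: r_coset_def)
      qed
      show "L #> u \<subseteq> u <# L"
      proof
        fix v assume "v \<in> L #> u"
        then obtain l where l: "l \<in> L" "v = l \<otimes> u" by (auto simp: r_coset_def)
        then have "v = u \<otimes> (inv u \<otimes> l \<otimes> inv (inv u))"
          using uG LG by (simp add: m_assoc inv_mult_cancel_left)
        then show "v \<in> u <# L" using L_conj[OF Hi[OF uH] l(1)] by (auto simp: l_coset_def)
      qed
    qed
    then have normF: "u <#\<^bsub>?F\<^esub> L = L #>\<^bsub>?F\<^esub> u" by (simp add: l_coset_def r_coset_def)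
    have ordF: "n = 0" if "u [^]\<^bsub>?F\<^esub> n \<in> L" for n :: nat
    proof -
      have "u [^] int n \<in> L" using that by (simp add: nat_pow_consistent[symmetric] int_pow_int)
      then have "int n * \<beta> u = 0" using uH by (metis L_iff \<beta>.char_int_pow)
      then show ?thesis using 3 by simp
    qed
    have splitF: "\<exists>l\<in>L. \<exists>n::int. k = l \<otimes>\<^bsub>?F\<^esub> u [^]\<^bsub>?F\<^esub> n" if "k \<in> K" for k
      using K_split[OF that] int_pow_consistent[OF F uF] by simp
    have u_YF: "\<exists>z\<in>L. z \<otimes>\<^bsub>?F\<^esub> (u \<otimes>\<^bsub>?F\<^esub> x \<otimes>\<^bsub>?F\<^esub> inv\<^bsub>?F\<^esub> u) \<otimes>\<^bsub>?F\<^esub> inv\<^bsub>?F\<^esub> z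
        \<in> generate ?F (Y (n + c))" if x: "x \<in> Y n" for n x
    proof -
      have "Y (n + c) \<subseteq> F" using YL LF by blast
      then show ?thesis using u_Y[OF x] LF uF by (auto simp: gen_F inv_F subset_eq)
    qed
    have LF_gen: "L \<subseteq> (\<Union>n. generate ?F (Y n))"
    proof -
      have "Y n \<subseteq> F" for n using YL LF by blast
      then show ?thesis using LV by (simp add: gen_F V_def)
    qed
    obtain Z where Z: "finite Z" "Z \<subseteq> K" "generate ?F Z = K"
      using F.fin_gen_of_growth[OF free subgroup_incl[OF L F LF] subgroup_incl[OF K F KF] LK u normF
          ordF splitF finY monoY YL LF_gen growth u_YF] by blast
    then have "generate G Z = K" using gen_F KF by auto
    then show thesis using that Z K_eq by blast
  qed
qed

end

section \<open>Application to the semidirect product\<close>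

text \<open>\<open>\<beta>\<close> is the quotient map followed by the isomorphism to the integers,
  and \<open>s\<close> is a preimage of \<open>1\<close>.\<close>

lemma (in group) int_character_of_iso_quotient:
  assumes H: "subgroup H G" and N: "N \<lhd> G\<lparr>carrier := H\<rparr>"
    and iso: "(G\<lparr>carrier := H\<rparr> Mod N) \<cong> integer_group"
  obtains \<beta> s where "int_character G H \<beta>" "\<And>h. h \<in> H \<Longrightarrow> h \<in> N \<longleftrightarrow> \<beta> h = 0" "s \<in> H" "\<beta> s \<noteq> 0"
proof -
  let ?H = "G\<lparr>carrier := H\<rparr>"
  interpret N: normal N ?H by fact
  obtain \<psi> where \<psi>: "\<psi> \<in> hom (?H Mod N) integer_group" "bij_betw \<psi> (carrier (?H Mod N)) UNIV"
    using iso by (auto simp: is_iso_def iso_def)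
  define \<beta> where "\<beta> h = \<psi> (N #>\<^bsub>?H\<^esub> h)" for h
  have q: "(\<lambda>h. N #>\<^bsub>?H\<^esub> h) \<in> hom ?H (?H Mod N)" by (rule N.r_coset_hom_Mod)
  have cos: "N #>\<^bsub>?H\<^esub> h \<in> carrier (?H Mod N)" if "h \<in> H" for h
    using hom_in_carrier[OF q, of h] that by simp
  have mult: "\<beta> (x \<otimes> y) = \<beta> x + \<beta> y" if "x \<in> H" "y \<in> H" for x y
    using hom_mult[OF q, of x y] hom_mult[OF \<psi>(1) cos cos, of x y] that by (simp add: \<beta>_def)
  have char: "int_character G H \<beta>"
    using is_group H mult by (intro int_character.intro int_character_axioms.intro)
  have NH: "N \<subseteq> H" using N.subset by simp
  have N_cos: "N #>\<^bsub>?H\<^esub> h = N \<longleftrightarrow> h \<in> N" if "h \<in> H" for h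
    using that N.subgroup_axioms N.coset_join1[of N h] N.coset_join2[of h N] by auto
  have "\<psi> N = 0"
    using hom_one[OF \<psi>(1) N.factorgroup_is_group group_integer_group] by (simp add: FactGroup_def)
  moreover have "N \<in> carrier (?H Mod N)"
    using subgroup.subgroup_in_rcosets[OF N.subgroup_axioms N.is_group] by (simp add: FactGroup_def)
  ultimately have ker: "h \<in> N \<longleftrightarrow> \<beta> h = 0" if "h \<in> H" for h
    using N_cos[OF that] \<psi>(2) cos[OF that] unfolding \<beta>_def bij_betw_def inj_on_def by metis
  obtain c where c: "c \<in> carrier (?H Mod N)" "\<psi> c = 1"
    using \<psi>(2) unfolding bij_betw_def by (metis UNIV_I imageE)
  then obtain s where "s \<in> H" "c = N #>\<^bsub>?H\<^esub> s"
    by (auto simp: FactGroup_def RCOSETS_def)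
  then show thesis using that[OF char ker, of s] c(2) by (simp add: \<beta>_def)
qed

theorem lemma3p5:
  fixes F :: "('a, 'b) monoid_scheme" and \<Phi> :: "'a \<Rightarrow> 'a" and H :: "('a \<times> int) set"
  assumes "free_group F"
    and "fin_gen_group F"
    and "\<not> trivial_group F"
    and "\<Phi> \<in> auto F"
    and "subgroup H (semidirect_int F \<Phi>)"
    and "free_by_cyclic ((semidirect_int F \<Phi>)\<lparr>carrier := H\<rparr>)"
  shows "fin_gen_group ((semidirect_int F \<Phi>)\<lparr>carrier := H \<inter> (carrier F \<times> {0})\<rparr>)"
proof -
  interpret F: group F using assms(1) by (simp add: free_group_def)
  define G where "G = semidirect_int F \<Phi>"
  define F0 where "F0 = carrier F \<times> {0::int}"
  interpret G: group G unfolding G_def using F.group_semidirect_int[OF assms(4)] .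
  have H: "subgroup H G" using assms(5) by (simp add: G_def)
  have F0: "subgroup F0 G"
    unfolding G_def F0_def using F.normal_semidirect_int[OF assms(4)] by (rule normal_imp_subgroup)
  obtain B where B: "free_on F B" using assms(1) by (auto simp: free_group_def)
  have free: "free_on (G\<lparr>carrier := F0\<rparr>) ((\<lambda>x. (x, 0)) ` B)"
    using free_on_iso[OF F.is_group G.subgroup_imp_group[OF F0] _ B]
      F.iso_semidirect_int[OF assms(4)] by (simp add: G_def F0_def)
  have HG: "H \<subseteq> carrier G" using H by (rule subgroup.subset)
  \<comment> \<open>The exponent of the stable letter is the character whose kernel is the
    intersection with the free group.\<close>
  have \<alpha>: "int_character G H snd"
    using G.is_group H by (intro int_character.intro int_character_axioms.intro)
      (auto simp: G_def semidirect_int_def split: prod.splits)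
  have \<alpha>_F: "h \<in> F0 \<longleftrightarrow> snd h = 0" if "h \<in> H" for h
    using that HG by (cases h) (auto simp: F0_def G_def semidirect_int_def)
  obtain N where N: "N \<lhd> G\<lparr>carrier := H\<rparr>" and N_fg: "fin_gen_group (G\<lparr>carrier := N\<rparr>)"
    and iso: "(G\<lparr>carrier := H\<rparr> Mod N) \<cong> integer_group"
    using assms(6) by (auto simp: free_by_cyclic_def G_def)
  obtain \<beta> s where \<beta>: "int_character G H \<beta>" and ker: "\<And>h. h \<in> H \<Longrightarrow> h \<in> N \<longleftrightarrow> \<beta> h = 0"
    and s: "s \<in> H" "\<beta> s \<noteq> 0"
    using G.int_character_of_iso_quotient[OF H N iso] by blast
  have NH: "N \<subseteq> H" using normal_imp_subgroup[OF N] subgroup.subset by fastforce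
  have NG: "subgroup N G" using G.incl_subgroup[OF H normal_imp_subgroup[OF N]] .
  obtain P where P: "finite P" "P \<subseteq> N" "generate (G\<lparr>carrier := N\<rparr>) P = N"
    using N_fg by (auto simp: fin_gen_group_def)
  have "N = {h \<in> H. \<beta> h = 0}" using ker NH by auto
  then have "generate G P = {h \<in> H. \<beta> h = 0}"
    using P G.generate_consistent[OF P(2) NG] by simp
  then obtain Z where Z: "finite Z" "Z \<subseteq> H \<inter> F0" "generate G Z = H \<inter> F0"
    using G.kernel_in_free_fin_gen[OF F0 free \<alpha> \<beta> \<alpha>_F s P(1)] by blast
  have HF: "subgroup (H \<inter> F0) G" using H F0 by (rule G.subgroups_Inter_pair)
  have "fin_gen_group (G\<lparr>carrier := H \<inter> F0\<rparr>)"
    unfolding fin_gen_group_def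
    using Z G.subgroup_imp_group[OF HF] G.generate_consistent[OF Z(2) HF] by auto
  then show ?thesis by (simp add: G_def F0_def)
qed

end
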